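(* Let $\zeta_1,\zeta_2,\eta$ be fixed, and let $\zeta_1(s)=\zeta_1(s;\psi_1,\psi_2,\zeta_1,\zeta_2,\eta,\eta_0,t)$, $\zeta_2(s)=\zeta_2(s;\psi_1,\psi_2,\zeta_1,\zeta_2,\eta,\eta_0,t)$, and $\eta(s)=\eta(s;\psi_1,\psi_2,\eta,\eta_0,t)$ be solutions to the Hamiltonian system $\dot\zeta_i=\partial H/\partial\psi_i$, $\dot\psi_i=-\partial H/\partial\zeta_i$ ($i=1,2$), $\dot\eta=\partial H/\partial\theta$, $\dot\theta=-\partial H/\partial\eta$ with the mixed boundary conditions $$\eta(0)=\eta_0,\quad \eta(t)=\eta,\quad \zeta_1(t)=\zeta_1,\quad \zeta_2(t)=\zeta_2,\quad \psi_1(0)=\psi_1,\quad \psi_2(0)=\psi_2,$$ and with the Hamiltonian $H(\zeta_1(s),\zeta_2(s),\eta(s),\psi_1,\psi_2,\theta(s))$. The modified action $$g=\psi_1\zeta_1+\psi_2\zeta_2+\int_0^t\big(\theta(s)\dot\eta(s)-H\big)\,ds$$ satisfies the Hamilton–Jacobi equation $$\frac{\partial g}{\partial t}+H(\zeta_1,\zeta_2,\eta,\nabla g)=0,$$ where the gradient $\nabla$ is taken with respect to the coordinates of the endpoint $(\zeta_1,\zeta_2,\eta)$.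
   Context: Hyperspherical coordinates $(\zeta_1,\zeta_2,\eta)$ on the unit sphere $\mathbb S^3\subset\mathbb R^4$ are given by $x_1+ix_2=e^{i\zeta_1}\cos\eta$, $x_3+ix_4=e^{i\zeta_2}\sin\eta$, $\eta\in(0,\pi/2)$, $\zeta_1,\zeta_2\in[-\pi,\pi)$. The covector variables dual to $\zeta_1,\zeta_2,\eta$ are $\psi_1,\psi_2,\theta$. The Hamiltonian is $$H(\zeta_1,\zeta_2,\eta,\psi_1,\psi_2,\theta)=\tfrac12\big(\psi_1^2\tan^2\eta+\psi_2^2\cot^2\eta+4\theta^2+2\psi_1\psi_2\big).$$ Explicitly, the Hamiltonian system reads $\dot\zeta_1=\psi_1\tan^2\eta+\psi_2$, $\dot\zeta_2=\psi_2\cot^2\eta+\psi_1$, $\dot\eta=4\theta$, $\dot\psi_1=\dot\psi_2=0$, $\dot\theta=-\psi_1^2\frac{\tan\eta}{\cos^2\eta}+\psi_2^2\frac{\cot\eta}{\sin^2\eta}$, where the dot is the derivative with respect to $s\in[0,t]$; thus $\psi_1,\psi_2$ are constants and $H$ is constant along each solution. The function $g=g(\zeta_1,\zeta_2,\eta_0,\eta,\psi_1,\psi_2,t)$ is regarded as a function of the boundary data, and $H(\zeta_1,\zeta_2,\eta,\nabla g)$ means that $(\psi_1,\psi_2,\theta)$ is replaced by $\nabla g=\big(\frac{\partial g}{\partial\zeta_1},\frac{\partial g}{\partial\zeta_2},\frac{\partial g}{\partial\eta}\big)$. The boundary data allow a countable number of possible values of the constant of integration $\theta_0=\theta(0)$;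 the value is not specified.
   Formalization: The solutions are assumed to form one branch, given for all (η,t) in an open set with t>0, along which θ(0) is a continuous function of (η,t); with θ(0) chosen independently for each (η,t), g may be discontinuous and ∇g undefined. Differentiability of g is proved. *)

theory Defs
  imports "HOL-Analysis.Analysis"
begin

text \<open>The arguments are the hyperspherical coordinates
  \<open>\<zeta>\<^sub>1, \<zeta>\<^sub>2, \<eta>\<close> followed by the dual covector variables \<open>\<psi>\<^sub>1, \<psi>\<^sub>2, \<theta>\<close>.\<close>

definition Ham :: "real \<Rightarrow> real \<Rightarrow> real \<Rightarrow> real \<Rightarrow> real \<Rightarrow> real \<Rightarrow> real" where
  "Ham \<zeta>\<^sub>1 \<zeta>\<^sub>2 \<eta> \<psi>\<^sub>1 \<psi>\<^sub>2 \<theta> =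
     1 / 2 * (\<psi>\<^sub>1\<^sup>2 * (tan \<eta>)\<^sup>2 + \<psi>\<^sub>2\<^sup>2 * (cot \<eta>)\<^sup>2 + 4 * \<theta>\<^sup>2 + 2 * \<psi>\<^sub>1 * \<psi>\<^sub>2)"

text \<open>The angles \<open>\<zeta>\<^sub>1, \<zeta>\<^sub>2\<close> are lifted to the real line, so that a curve may wind around the
  torus; \<open>\<eta>\<close> has to stay in the coordinate domain. Derivatives at the two end points
  of \<open>[0,t]\<close> are one-sided.\<close>

definition hamiltonian_solution ::
  "real \<Rightarrow> (real \<Rightarrow> real) \<Rightarrow> (real \<Rightarrow> real) \<Rightarrow> (real \<Rightarrow> real) \<Rightarrow>
   (real \<Rightarrow> real) \<Rightarrow> (real \<Rightarrow> real) \<Rightarrow> (real \<Rightarrow> real) \<Rightarrow> bool" where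
  "hamiltonian_solution t z\<^sub>1 z\<^sub>2 e p\<^sub>1 p\<^sub>2 th \<longleftrightarrow>
    (\<forall>s\<in>{0..t}.
      0 < e s \<and> e s < pi / 2 \<and>
      (z\<^sub>1 has_real_derivative
         deriv (\<lambda>p. Ham (z\<^sub>1 s) (z\<^sub>2 s) (e s) p (p\<^sub>2 s) (th s)) (p\<^sub>1 s)) (at s within {0..t}) \<and>
      (z\<^sub>2 has_real_derivative
         deriv (\<lambda>p. Ham (z\<^sub>1 s) (z\<^sub>2 s) (e s) (p\<^sub>1 s) p (th s)) (p\<^sub>2 s)) (at s within {0..t}) \<and>
      (e has_real_derivative
         deriv (\<lambda>p. Ham (z\<^sub>1 s) (z\<^sub>2 s) (e s) (p\<^sub>1 s) (p\<^sub>2 s) p) (th s)) (at s within {0..t}) \<and>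
      (p\<^sub>1 has_real_derivative
         - deriv (\<lambda>q. Ham q (z\<^sub>2 s) (e s) (p\<^sub>1 s) (p\<^sub>2 s) (th s)) (z\<^sub>1 s)) (at s within {0..t}) \<and>
      (p\<^sub>2 has_real_derivative
         - deriv (\<lambda>q. Ham (z\<^sub>1 s) q (e s) (p\<^sub>1 s) (p\<^sub>2 s) (th s)) (z\<^sub>2 s)) (at s within {0..t}) \<and>
      (th has_real_derivative
         - deriv (\<lambda>q. Ham (z\<^sub>1 s) (z\<^sub>2 s) q (p\<^sub>1 s) (p\<^sub>2 s) (th s)) (e s)) (at s within {0..t}))"

definition mixed_boundary_conditions ::
  "real \<Rightarrow> real \<Rightarrow> real \<Rightarrow> real \<Rightarrow> real \<Rightarrow> real \<Rightarrow> real \<Rightarrow>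
   (real \<Rightarrow> real) \<Rightarrow> (real \<Rightarrow> real) \<Rightarrow> (real \<Rightarrow> real) \<Rightarrow>
   (real \<Rightarrow> real) \<Rightarrow> (real \<Rightarrow> real) \<Rightarrow> bool" where
  "mixed_boundary_conditions \<psi>\<^sub>1 \<psi>\<^sub>2 \<eta>\<^sub>0 \<zeta>\<^sub>1 \<zeta>\<^sub>2 \<eta> t z\<^sub>1 z\<^sub>2 e p\<^sub>1 p\<^sub>2 \<longleftrightarrow>
     e 0 = \<eta>\<^sub>0 \<and> e t = \<eta> \<and> z\<^sub>1 t = \<zeta>\<^sub>1 \<and> z\<^sub>2 t = \<zeta>\<^sub>2 \<and> p\<^sub>1 0 = \<psi>\<^sub>1 \<and> p\<^sub>2 0 = \<psi>\<^sub>2"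

text \<open>A branch of solutions of the boundary value problem, for fixed \<open>\<psi>\<^sub>1, \<psi>\<^sub>2, \<eta>\<^sub>0\<close> and for
  all end data \<open>\<zeta>\<^sub>1, \<zeta>\<^sub>2\<close> and \<open>(\<eta>, t)\<close> in \<open>D\<close>. The last argument of each family is the time \<open>s\<close>;
  the families \<open>e\<close> and \<open>th\<close> do not depend on \<open>\<zeta>\<^sub>1, \<zeta>\<^sub>2\<close>.
  The boundary data determine \<open>\<theta>(0)\<close> only up to a countable choice, and a choice made
  independently for different \<open>(\<eta>, t)\<close> would not give a differentiable action.
  The continuity condition says that one branch is followed; it is the only
  regularity in the boundary data that is required.\<close>

definition solution_branch ::
  "real \<Rightarrow> real \<Rightarrow> real \<Rightarrow> (real \<times> real) set \<Rightarrow>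
   (real \<Rightarrow> real \<Rightarrow> real \<Rightarrow> real \<Rightarrow> real \<Rightarrow> real) \<Rightarrow> (real \<Rightarrow> real \<Rightarrow> real \<Rightarrow> real \<Rightarrow> real \<Rightarrow> real) \<Rightarrow>
   (real \<Rightarrow> real \<Rightarrow> real \<Rightarrow> real) \<Rightarrow>
   (real \<Rightarrow> real \<Rightarrow> real \<Rightarrow> real \<Rightarrow> real \<Rightarrow> real) \<Rightarrow> (real \<Rightarrow> real \<Rightarrow> real \<Rightarrow> real \<Rightarrow> real \<Rightarrow> real) \<Rightarrow>
   (real \<Rightarrow> real \<Rightarrow> real \<Rightarrow> real) \<Rightarrow> bool" where
  "solution_branch \<psi>\<^sub>1 \<psi>\<^sub>2 \<eta>\<^sub>0 D z\<^sub>1 z\<^sub>2 e p\<^sub>1 p\<^sub>2 th \<longleftrightarrow>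
     (\<forall>\<zeta>\<^sub>1 \<zeta>\<^sub>2. \<forall>(\<eta>, t)\<in>D.
        hamiltonian_solution t (z\<^sub>1 \<zeta>\<^sub>1 \<zeta>\<^sub>2 \<eta> t) (z\<^sub>2 \<zeta>\<^sub>1 \<zeta>\<^sub>2 \<eta> t) (e \<eta> t)
          (p\<^sub>1 \<zeta>\<^sub>1 \<zeta>\<^sub>2 \<eta> t) (p\<^sub>2 \<zeta>\<^sub>1 \<zeta>\<^sub>2 \<eta> t) (th \<eta> t) \<and>
        mixed_boundary_conditions \<psi>\<^sub>1 \<psi>\<^sub>2 \<eta>\<^sub>0 \<zeta>\<^sub>1 \<zeta>\<^sub>2 \<eta> t
          (z\<^sub>1 \<zeta>\<^sub>1 \<zeta>\<^sub>2 \<eta> t) (z\<^sub>2 \<zeta>\<^sub>1 \<zeta>\<^sub>2 \<eta> t) (e \<eta> t) (p\<^sub>1 \<zeta>\<^sub>1 \<zeta>\<^sub>2 \<eta> t) (p\<^sub>2 \<zeta>\<^sub>1 \<zeta>\<^sub>2 \<eta> t)) \<and>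
     continuous_on D (\<lambda>(\<eta>, t). th \<eta> t 0)"

definition modified_action ::
  "real \<Rightarrow> real \<Rightarrow>
   (real \<Rightarrow> real \<Rightarrow> real \<Rightarrow> real \<Rightarrow> real \<Rightarrow> real) \<Rightarrow> (real \<Rightarrow> real \<Rightarrow> real \<Rightarrow> real \<Rightarrow> real \<Rightarrow> real) \<Rightarrow>
   (real \<Rightarrow> real \<Rightarrow> real \<Rightarrow> real) \<Rightarrow> (real \<Rightarrow> real \<Rightarrow> real \<Rightarrow> real) \<Rightarrow>
   real \<Rightarrow> real \<Rightarrow> real \<Rightarrow> real \<Rightarrow> real" where
  "modified_action \<psi>\<^sub>1 \<psi>\<^sub>2 z\<^sub>1 z\<^sub>2 e th \<zeta>\<^sub>1 \<zeta>\<^sub>2 \<eta> t =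
     \<psi>\<^sub>1 * \<zeta>\<^sub>1 + \<psi>\<^sub>2 * \<zeta>\<^sub>2 +
     integral {0..t} (\<lambda>s.
       th \<eta> t s * vector_derivative (e \<eta> t) (at s within {0..t})
       - Ham (z\<^sub>1 \<zeta>\<^sub>1 \<zeta>\<^sub>2 \<eta> t s) (z\<^sub>2 \<zeta>\<^sub>1 \<zeta>\<^sub>2 \<eta> t s) (e \<eta> t s) \<psi>\<^sub>1 \<psi>\<^sub>2 (th \<eta> t s))"

lemma Ham_partial_derivatives:
  assumes "0 < \<eta>" "\<eta> < pi / 2"
  shows "deriv (\<lambda>q. Ham q \<zeta>\<^sub>2 \<eta> \<psi>\<^sub>1 \<psi>\<^sub>2 \<theta>) \<zeta>\<^sub>1 = 0"
    and "deriv (\<lambda>q. Ham \<zeta>\<^sub>1 q \<eta> \<psi>\<^sub>1 \<psi>\<^sub>2 \<theta>) \<zeta>\<^sub>2 = 0"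
    and "deriv (\<lambda>q. Ham \<zeta>\<^sub>1 \<zeta>\<^sub>2 q \<psi>\<^sub>1 \<psi>\<^sub>2 \<theta>) \<eta> =
           \<psi>\<^sub>1\<^sup>2 * (tan \<eta> / (cos \<eta>)\<^sup>2) - \<psi>\<^sub>2\<^sup>2 * (cot \<eta> / (sin \<eta>)\<^sup>2)"
    and "deriv (\<lambda>p. Ham \<zeta>\<^sub>1 \<zeta>\<^sub>2 \<eta> p \<psi>\<^sub>2 \<theta>) \<psi>\<^sub>1 = \<psi>\<^sub>1 * (tan \<eta>)\<^sup>2 + \<psi>\<^sub>2"
    and "deriv (\<lambda>p. Ham \<zeta>\<^sub>1 \<zeta>\<^sub>2 \<eta> \<psi>\<^sub>1 p \<theta>) \<psi>\<^sub>2 = \<psi>\<^sub>2 * (cot \<eta>)\<^sup>2 + \<psi>\<^sub>1"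
    and "deriv (\<lambda>p. Ham \<zeta>\<^sub>1 \<zeta>\<^sub>2 \<eta> \<psi>\<^sub>1 \<psi>\<^sub>2 p) \<theta> = 4 * \<theta>"
proof -
  have s: "sin \<eta> \<noteq> 0" using assms sin_gt_zero[of \<eta>] by (simp add: less_imp_neq[symmetric])
  have c: "cos \<eta> \<noteq> 0" using assms cos_gt_zero[of \<eta>] by simp
  show "deriv (\<lambda>q. Ham q \<zeta>\<^sub>2 \<eta> \<psi>\<^sub>1 \<psi>\<^sub>2 \<theta>) \<zeta>\<^sub>1 = 0" "deriv (\<lambda>q. Ham \<zeta>\<^sub>1 q \<eta> \<psi>\<^sub>1 \<psi>\<^sub>2 \<theta>) \<zeta>\<^sub>2 = 0"
    by (simp_all add: Ham_def)
  show "deriv (\<lambda>q. Ham \<zeta>\<^sub>1 \<zeta>\<^sub>2 q \<psi>\<^sub>1 \<psi>\<^sub>2 \<theta>) \<eta> =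
           \<psi>\<^sub>1\<^sup>2 * (tan \<eta> / (cos \<eta>)\<^sup>2) - \<psi>\<^sub>2\<^sup>2 * (cot \<eta> / (sin \<eta>)\<^sup>2)"
    unfolding Ham_def
    by (rule DERIV_imp_deriv, (rule derivative_eq_intros DERIV_cot refl s c)+)
       (simp add: field_simps s c)
  show "deriv (\<lambda>p. Ham \<zeta>\<^sub>1 \<zeta>\<^sub>2 \<eta> p \<psi>\<^sub>2 \<theta>) \<psi>\<^sub>1 = \<psi>\<^sub>1 * (tan \<eta>)\<^sup>2 + \<psi>\<^sub>2"
    "deriv (\<lambda>p. Ham \<zeta>\<^sub>1 \<zeta>\<^sub>2 \<eta> \<psi>\<^sub>1 p \<theta>) \<psi>\<^sub>2 = \<psi>\<^sub>2 * (cot \<eta>)\<^sup>2 + \<psi>\<^sub>1"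
    "deriv (\<lambda>p. Ham \<zeta>\<^sub>1 \<zeta>\<^sub>2 \<eta> \<psi>\<^sub>1 \<psi>\<^sub>2 p) \<theta> = 4 * \<theta>"
    unfolding Ham_def
    by (rule DERIV_imp_deriv, (rule derivative_eq_intros refl)+, simp add: field_simps)+
qed

end

theory Submission
  imports Defs
begin

text \<open>Since \<open>H\<close> does not contain \<open>\<zeta>\<^sub>1, \<zeta>\<^sub>2\<close>, the momenta \<open>\<psi>\<^sub>1, \<psi>\<^sub>2\<close> are constants and the pair
  \<open>(\<eta>(s), \<theta>(s))\<close> moves by itself as a particle on a line, with Hamiltonian
  \<open>H = 2\<theta>\<^sup>2 + V(\<eta>)\<close> and \<open>V = (\<psi>\<^sub>1\<^sup>2 tan\<^sup>2 + \<psi>\<^sub>2\<^sup>2 cot\<^sup>2) / 2 + \<psi>\<^sub>1\<psi>\<^sub>2\<close>. The modified action is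
  \<open>g = \<psi>\<^sub>1\<zeta>\<^sub>1 + \<psi>\<^sub>2\<zeta>\<^sub>2 + W(\<eta>, t)\<close>, where \<open>W\<close> is the integral of the Lagrangian
  \<open>\<theta>\<eta>' - H = 2\<theta>\<^sup>2 - V(\<eta>)\<close>. So \<open>\<nabla>g = (\<psi>\<^sub>1, \<psi>\<^sub>2, \<partial>W/\<partial>\<eta>)\<close>, and the theorem says that
  \<open>\<partial>W/\<partial>\<eta> = \<theta>(t)\<close> and \<open>\<partial>W/\<partial>t = -(2\<theta>(t)\<^sup>2 + V(\<eta>))\<close>.

  The classical derivation differentiates the trajectory with respect to its end data. Here the
  branch depends on them through the initial momentum \<open>\<phi>(\<eta>, t) = \<theta>(0)\<close>, which is only known to be
  continuous. The proof therefore never differentiates \<open>\<phi>\<close>.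

  \<^item> For two trajectories from the same point, with initial momenta differing by \<open>\<delta>\<close>, the action
    changes by \<open>\<theta>(t)\<close> times the displacement of the end point, up to an error \<open>O(\<delta>\<^sup>2)\<close>
    (\<open>action_first_variation\<close>, from a Gronwall estimate).
  \<^item> For fixed \<open>t\<close> the function \<open>\<phi>(\<cdot>, t)\<close> is continuous and injective, because a trajectory is
    determined by its initial momentum; so it is monotone. Subdividing an interval of end points
    into \<open>n\<close> pieces with equal increments of \<open>\<phi>\<close> makes the total error \<open>n \<cdot> O(1/n\<^sup>2)\<close>, which vanishes
    in the limit (\<open>mean_value_bound_monotone_parameter\<close>). This gives \<open>\<partial>W/\<partial>\<eta> = \<theta>(t)\<close>.
  \<^item> For the time derivative let \<open>t\<^sub>1 < t\<^sub>2\<close>. The trajectory that ends in \<open>\<eta>\<close> at time \<open>t\<^sub>2\<close> passes at time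
    \<open>t\<^sub>1\<close> through a point \<open>x\<close>, and up to then it is the trajectory of the branch that ends in \<open>x\<close> at
    time \<open>t\<^sub>1\<close> (\<open>nearby_times_share_start_momentum\<close>). Thus \<open>W(\<eta>, t\<^sub>2) - W(x, t\<^sub>1)\<close> is an integral of
    \<open>2\<theta>\<^sup>2 - V\<close> over \<open>[t\<^sub>1, t\<^sub>2]\<close>, and by the previous item \<open>W(\<eta>, t\<^sub>1) - W(x, t\<^sub>1)\<close> is about
    \<open>\<theta> (\<eta> - x)\<close>, that is \<open>4\<theta>\<^sup>2 (t\<^sub>2 - t\<^sub>1)\<close>. The difference is \<open>-(2\<theta>\<^sup>2 + V)(t\<^sub>2 - t\<^sub>1)\<close> to first order.

  The estimates need a force that is bounded and Lipschitz along all trajectories in question.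
  Conservation of energy provides this: it keeps \<open>\<psi>\<^sub>1 tan \<eta>\<close> and \<open>\<psi>\<^sub>2 cot \<eta>\<close> bounded.\<close>

section \<open>Trajectories of a particle on a line\<close>

text \<open>Hamilton's equations for \<open>2\<theta>\<^sup>2 + V(\<eta>)\<close>, with \<open>f\<close> in the role of \<open>V'\<close>.\<close>

definition trajectory :: "(real \<Rightarrow> real) \<Rightarrow> real \<Rightarrow> (real \<Rightarrow> real) \<Rightarrow> (real \<Rightarrow> real) \<Rightarrow> bool" where
  "trajectory f t e th \<longleftrightarrow> (\<forall>s\<in>{0..t}.
     (e has_real_derivative 4 * th s) (at s within {0..t}) \<and>
     (th has_real_derivative - f (e s)) (at s within {0..t}))"

lemma trajectoryD:
  assumes "trajectory f t e th" "s \<in> {0..t}"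
  shows "(e has_real_derivative 4 * th s) (at s within {0..t})"
    and "(th has_real_derivative - f (e s)) (at s within {0..t})"
  using assms by (auto simp: trajectory_def)

lemma trajectory_continuous:
  assumes "trajectory f t e th"
  shows "continuous_on {0..t} e" "continuous_on {0..t} th"
  by (rule DERIV_continuous_on, erule trajectoryD[OF assms])+

lemma trajectory_restrict:
  assumes "trajectory f t e th" "t' \<le> t"
  shows "trajectory f t' e th"
proof -
  have sub: "{0..t'} \<subseteq> {0..t}" using assms by auto
  show ?thesis
    unfolding trajectory_def
  proof (intro ballI conjI)
    fix s assume "s \<in> {0..t'}"
    then have s: "s \<in> {0..t}" using sub by blast
    show "(e has_real_derivative 4 * th s) (at s within {0..t'})"
      by (rule DERIV_subset[OF trajectoryD(1)[OF assms(1) s] sub])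
    show "(th has_real_derivative - f (e s)) (at s within {0..t'})"
      by (rule DERIV_subset[OF trajectoryD(2)[OF assms(1) s] sub])
  qed
qed

text \<open>The bounds on the potential that all later estimates use. A single constant \<open>M\<close> serves for the
  size and for the Lipschitz constant of the force; \<open>J\<close> is convex so that mean value estimates
  apply between points of different trajectories.\<close>

definition lipschitz_force :: "(real \<Rightarrow> real) \<Rightarrow> (real \<Rightarrow> real) \<Rightarrow> real set \<Rightarrow> real \<Rightarrow> bool" where
  "lipschitz_force V f J M \<longleftrightarrow> convex J \<and> 0 \<le> M \<and>
     (\<forall>x\<in>J. (V has_real_derivative f x) (at x within J) \<and> \<bar>f x\<bar> \<le> M) \<and>
     (\<forall>x\<in>J. \<forall>y\<in>J. \<bar>f y - f x\<bar> \<le> M * \<bar>y - x\<bar>)"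

lemma lipschitz_forceD:
  assumes "lipschitz_force V f J M"
  shows "convex J" "0 \<le> M"
    "\<And>x. x \<in> J \<Longrightarrow> (V has_real_derivative f x) (at x within J)"
    "\<And>x. x \<in> J \<Longrightarrow> \<bar>f x\<bar> \<le> M"
    "\<And>x y. x \<in> J \<Longrightarrow> y \<in> J \<Longrightarrow> \<bar>f y - f x\<bar> \<le> M * \<bar>y - x\<bar>"
  using assms unfolding lipschitz_force_def by blast+

text \<open>Gronwall: the squared distance \<open>r\<close> in phase space satisfies \<open>r' \<le> (4 + M) r\<close>, so
  \<open>exp (-(4 + M) s) r(s)\<close> decreases. The \<open>4\<close> comes from \<open>\<eta>' = 4\<theta>\<close>.\<close>

lemma trajectory_stability:
  fixes f :: "real \<Rightarrow> real"
  assumes T: "trajectory f t e th" and T': "trajectory f t e' th'"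
    and J: "\<And>s. s \<in> {0..t} \<Longrightarrow> e s \<in> J" "\<And>s. s \<in> {0..t} \<Longrightarrow> e' s \<in> J"
    and lip: "lipschitz_force V f J M" and init: "e' 0 = e 0" and s: "s \<in> {0..t}"
  shows "(e' s - e s)\<^sup>2 + (th' s - th s)\<^sup>2 \<le> exp ((4 + M) * t) * (th' 0 - th 0)\<^sup>2"
proof -
  note lip = lipschitz_forceD(5)[OF assms(5)] and M = lipschitz_forceD(2)[OF assms(5)]
  define K where "K = 4 + M"
  define r where "r s = (e' s - e s)\<^sup>2 + (th' s - th s)\<^sup>2" for s
  define r' where "r' s = 8 * (e' s - e s) * (th' s - th s)
      - 2 * (th' s - th s) * (f (e' s) - f (e s))" for s
  have der: "(r has_real_derivative r' s) (at s within {0..t})" if "s \<in> {0..t}" for s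
    unfolding r_def r'_def
    by (rule derivative_eq_intros refl trajectoryD[OF T that] trajectoryD[OF T' that])+
       (simp add: algebra_simps)
  have r'_le: "r' s \<le> K * r s" if "s \<in> {0..t}" for s
  proof -
    define a where "a = \<bar>e' s - e s\<bar>"
    define b where "b = \<bar>th' s - th s\<bar>"
    have nn: "0 \<le> a" "0 \<le> b" by (simp_all add: a_def b_def)
    have "(e' s - e s) * (th' s - th s) \<le> a * b"
      unfolding a_def b_def abs_mult[symmetric] by (rule abs_ge_self)
    moreover have "- (2 * (th' s - th s) * (f (e' s) - f (e s))) \<le> 2 * b * (M * a)"
    proof -
      have "- (2 * (th' s - th s) * (f (e' s) - f (e s)))
          \<le> \<bar>2 * (th' s - th s) * (f (e' s) - f (e s))\<bar>" by (rule abs_ge_minus_self)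
      also have "\<dots> = 2 * b * \<bar>f (e' s) - f (e s)\<bar>" by (simp only: abs_mult abs_numeral b_def)
      also have "\<dots> \<le> 2 * b * (M * a)"
        using lip[OF J(1)[OF that] J(2)[OF that]] nn by (intro mult_left_mono) (auto simp: a_def)
      finally show ?thesis .
    qed
    ultimately have "r' s \<le> K * (2 * a * b)"
      unfolding r'_def K_def by (simp only: algebra_simps)
    also have "\<dots> \<le> K * (a\<^sup>2 + b\<^sup>2)"
      using sum_squares_bound[of a b] M by (intro mult_left_mono) (auto simp: K_def)
    finally show ?thesis by (simp add: r_def a_def b_def)
  qed
  let ?q = "\<lambda>s. exp (- K * s) * r s"
  have qder: "(?q has_real_derivative exp (- K * s) * (r' s - K * r s)) (at s within {0..t})"
    if "s \<in> {0..t}" for s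
    by (rule derivative_eq_intros refl der[OF that])+ (simp add: algebra_simps)
  have "?q s \<le> ?q 0"
  proof (rule DERIV_nonpos_imp_decreasing_open[where f="?q"])
    show "0 \<le> s" using s by simp
    show "continuous_on {0..s} ?q"
      using s by (intro continuous_on_subset[OF DERIV_continuous_on[OF qder]]) auto
    fix x assume x: "0 < x" "x < s"
    then have x': "x \<in> {0..t}" and w: "at x within {0..t} = at x"
      using s by (auto simp: at_within_Icc_at)
    show "\<exists>y. DERIV ?q x :> y \<and> y \<le> 0"
      using qder[OF x'] r'_le[OF x'] unfolding w
      by (intro exI[where x="exp (- K * x) * (r' x - K * r x)"] conjI mult_nonneg_nonpos) simp_all
  qed
  then have "exp (K * s) * (exp (- K * s) * r s) \<le> exp (K * s) * r 0"
    by (intro mult_left_mono) simp_all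
  then have "r s \<le> exp (K * s) * r 0"
    by (simp add: mult.assoc[symmetric] exp_add[symmetric] del: mult.assoc)
  also have "\<dots> \<le> exp (K * t) * r 0"
  proof (rule mult_right_mono)
    show "exp (K * s) \<le> exp (K * t)"
      using s M by (simp add: K_def mult_left_mono)
    show "0 \<le> r 0" by (simp add: r_def)
  qed
  finally show ?thesis by (simp add: r_def K_def init)
qed

lemma quadratic_remainder:
  fixes V f :: "real \<Rightarrow> real"
  assumes L: "lipschitz_force V f J M" and "x \<in> J" "y \<in> J"
  shows "\<bar>V y - V x - f x * (y - x)\<bar> \<le> M * (y - x)\<^sup>2"
proof -
  note V = lipschitz_forceD(3)[OF L] and lip = lipschitz_forceD(5)[OF L]
  let ?S = "closed_segment x y"
  have sub: "?S \<subseteq> J" using assms lipschitz_forceD(1)[OF L] by (simp add: closed_segment_subset)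
  have "norm ((V y - f x * y) - (V x - f x * x)) \<le> (M * \<bar>y - x\<bar>) * norm (y - x)"
  proof (rule field_differentiable_bound[where S="?S" and f="\<lambda>z. V z - f x * z"])
    fix z assume z: "z \<in> ?S"
    then have "z \<in> J" using sub by auto
    show "((\<lambda>z. V z - f x * z) has_real_derivative f z - f x) (at z within ?S)"
      by (rule derivative_eq_intros refl DERIV_subset[OF V[OF \<open>z \<in> J\<close>] sub])+ simp
    have "\<bar>f z - f x\<bar> \<le> M * \<bar>z - x\<bar>" using lip \<open>z \<in> J\<close> \<open>x \<in> J\<close> by blast
    also have "\<dots> \<le> M * \<bar>y - x\<bar>"
      using z lipschitz_forceD(2)[OF L] by (intro mult_left_mono) (auto simp: closed_segment_eq_real_ivl split: if_splits)
    finally show "norm (f z - f x) \<le> M * \<bar>y - x\<bar>" by simp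
  qed auto
  moreover have "(M * \<bar>y - x\<bar>) * norm (y - x) = M * (y - x)\<^sup>2"
    by (simp add: power2_eq_square mult.assoc)
  ultimately show ?thesis by (simp add: algebra_simps)
qed

section \<open>First variation of the action\<close>

text \<open>The integrand is the Lagrangian \<open>\<theta>\<eta>' - H\<close> after substituting \<open>\<eta>' = 4\<theta>\<close>.\<close>

definition action :: "(real \<Rightarrow> real) \<Rightarrow> real \<Rightarrow> (real \<Rightarrow> real) \<Rightarrow> (real \<Rightarrow> real) \<Rightarrow> real" where
  "action V t e th = integral {0..t} (\<lambda>s. 2 * (th s)\<^sup>2 - V (e s))"

lemma action_has_derivative:
  assumes T: "trajectory f t e th" and J: "\<And>s. s \<in> {0..t} \<Longrightarrow> e s \<in> J"
    and V: "continuous_on J V" and s: "s \<in> {0..t}"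
  shows "((\<lambda>s. action V s e th) has_real_derivative 2 * (th s)\<^sup>2 - V (e s)) (at s within {0..t})"
proof -
  have "continuous_on {0..t} (\<lambda>s. V (e s))"
    by (rule continuous_on_compose2[OF V trajectory_continuous(1)[OF T]]) (use J in blast)
  moreover have "continuous_on {0..t} (\<lambda>s. 2 * (th s)\<^sup>2)"
    by (intro continuous_intros trajectory_continuous(2)[OF T])
  ultimately have "continuous_on {0..t} (\<lambda>s. 2 * (th s)\<^sup>2 - V (e s))"
    by (intro continuous_on_diff)
  then show ?thesis
    unfolding action_def using s by (rule integral_has_real_derivative)
qed

text \<open>The left hand side is the value at time \<open>t\<close> of a function that starts at \<open>0\<close>. In its derivative
  the terms linear in the difference of the trajectories cancel by Hamilton's equations; what is
  left is \<open>2(\<theta>' - \<theta>)\<^sup>2\<close> minus the quadratic Taylor remainder of \<open>V\<close>, and stability bounds both.\<close>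

lemma action_first_variation:
  fixes V f :: "real \<Rightarrow> real"
  assumes T: "trajectory f t e th" and T': "trajectory f t e' th'" and "0 \<le> t"
    and J: "\<And>s. s \<in> {0..t} \<Longrightarrow> e s \<in> J" "\<And>s. s \<in> {0..t} \<Longrightarrow> e' s \<in> J"
    and L: "lipschitz_force V f J M" and init: "e' 0 = e 0"
  shows "\<bar>action V t e' th' - action V t e th - th t * (e' t - e t)\<bar>
     \<le> (2 + M) * exp ((4 + M) * t) * t * (th' 0 - th 0)\<^sup>2"
proof -
  let ?B = "\<lambda>s. action V s e' th' - action V s e th - th s * (e' s - e s)"
  let ?b = "\<lambda>s. 2 * (th' s - th s)\<^sup>2 - (V (e' s) - V (e s) - f (e s) * (e' s - e s))"
  let ?C = "(2 + M) * (exp ((4 + M) * t) * (th' 0 - th 0)\<^sup>2)"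
  note M = lipschitz_forceD(2)[OF L]
  have cV: "continuous_on J V" using lipschitz_forceD(3)[OF L] by (rule DERIV_continuous_on)
  have "norm (?B t - ?B 0) \<le> ?C * norm (t - 0)"
  proof (rule field_differentiable_bound[where S="{0..t}" and f="?B" and f'="?b"])
    fix s assume s: "s \<in> {0..t}"
    show "(?B has_real_derivative ?b s) (at s within {0..t})"
    proof (rule DERIV_cong)
      have A: "((\<lambda>s. action V s e' th') has_real_derivative 2 * (th' s)\<^sup>2 - V (e' s)) (at s within {0..t})"
        "((\<lambda>s. action V s e th) has_real_derivative 2 * (th s)\<^sup>2 - V (e s)) (at s within {0..t})"
        using action_has_derivative[OF T' J(2) cV s] action_has_derivative[OF T J(1) cV s] by blast+
      show "(?B has_real_derivative 2 * (th' s)\<^sup>2 - V (e' s) - (2 * (th s)\<^sup>2 - V (e s))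
          - (- f (e s) * (e' s - e s) + (4 * th' s - 4 * th s) * th s)) (at s within {0..t})"
        by (intro DERIV_diff DERIV_mult A trajectoryD[OF T s] trajectoryD[OF T' s])
    qed (simp add: power2_eq_square algebra_simps)
    have "\<bar>V (e' s) - V (e s) - f (e s) * (e' s - e s)\<bar> \<le> M * (e' s - e s)\<^sup>2"
      by (rule quadratic_remainder[OF L J(1)[OF s] J(2)[OF s]])
    then have "\<bar>?b s\<bar> \<le> 2 * (th' s - th s)\<^sup>2 + M * (e' s - e s)\<^sup>2"
      using zero_le_power2[of "th' s - th s"] by linarith
    also have "\<dots> \<le> (2 + M) * ((e' s - e s)\<^sup>2 + (th' s - th s)\<^sup>2)"
      using M by (simp add: algebra_simps)
    also have "\<dots> \<le> ?C"
      using trajectory_stability[OF T T' J L init s] M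
      by (intro mult_left_mono) auto
    finally show "norm (?b s) \<le> ?C" by simp
  qed (use \<open>0 \<le> t\<close> in auto)
  moreover have "?B 0 = 0" by (simp add: action_def init)
  ultimately show ?thesis using \<open>0 \<le> t\<close> by (simp add: mult_ac)
qed

section \<open>Differentiation through a monotone parameter\<close>

text \<open>Cutting \<open>[a, b]\<close> into \<open>n\<close> equal pieces bounds the total increment by \<open>C (b - a)\<^sup>2 / n\<close>.\<close>

lemma quadratic_increments_nonpos:
  fixes k :: "real \<Rightarrow> real"
  assumes "a \<le> b" and k: "\<And>u v. a \<le> u \<Longrightarrow> u \<le> v \<Longrightarrow> v \<le> b \<Longrightarrow> k v - k u \<le> C * (v - u)\<^sup>2"
  shows "k b \<le> k a"
proof -
  have "k b - k a \<le> C * (b - a)\<^sup>2 * inverse (real (Suc n))" for n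
  proof -
    define N where "N = Suc n"
    define h where "h = (b - a) / N"
    have h: "0 \<le> h" "h * N = b - a" using \<open>a \<le> b\<close> by (auto simp: h_def N_def)
    have "k b - k a = (\<Sum>i<N. k (a + Suc i * h) - k (a + i * h))"
      using h(2) by (subst sum_lessThan_telescope) (simp add: mult.commute)
    also have "\<dots> \<le> (\<Sum>i<N. C * h\<^sup>2)"
    proof (rule sum_mono)
      fix i assume "i \<in> {..<N}"
      then have "real (Suc i) \<le> real N" by simp
      then have "real (Suc i) * h \<le> real N * h" using h(1) by (rule mult_right_mono)
      then have "a + real (Suc i) * h \<le> b" using h(2) by (simp add: mult.commute)
      moreover have "0 \<le> real i * h" "real (Suc i) * h - real i * h = h" 
        using h(1) by (simp_all add: algebra_simps)
      ultimately show "k (a + Suc i * h) - k (a + i * h) \<le> C * h\<^sup>2"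
        using k[of "a + i * h" "a + Suc i * h"] h(1) by auto
    qed
    also have "\<dots> = C * (b - a)\<^sup>2 * inverse (real (Suc n))"
      using h(2) by (simp add: h_def N_def power_divide) (simp add: power2_eq_square divide_inverse)
    finally show ?thesis .
  qed
  moreover have "(\<lambda>n. C * (b - a)\<^sup>2 * inverse (real (Suc n))) \<longlonglongrightarrow> C * (b - a)\<^sup>2 * 0"
    by (intro tendsto_intros LIMSEQ_inverse_real_of_nat)
  ultimately have "k b - k a \<le> 0"
    by (intro LIMSEQ_le_const[where X="\<lambda>n. C * (b - a)\<^sup>2 * inverse (real (Suc n))"]) auto
  then show ?thesis by simp
qed

text \<open>A substitute for the chain rule when the parameter \<open>\<phi>\<close> is only continuous and injective. Using
  \<open>u = \<phi> x\<close> as the variable turns the hypothesis on \<open>G\<close> into a bound on the increments of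
  \<open>\<plusminus>G - (\<plusminus>c + \<epsilon>) x\<close> that is quadratic in \<open>u\<close>. The displacements in \<open>x\<close> all have the same sign,
  because \<open>\<phi>\<close> is monotone, and this makes the \<open>\<epsilon>\<close> terms harmless.\<close>

lemma mean_value_bound_monotone_parameter:
  fixes G P \<phi> :: "real \<Rightarrow> real"
  assumes "a \<le> b" and cont: "continuous_on {a..b} \<phi>" and inj: "inj_on \<phi> {a..b}"
    and G: "\<And>x y. x \<in> {a..b} \<Longrightarrow> y \<in> {a..b} \<Longrightarrow> \<bar>G y - G x - P x * (y - x)\<bar> \<le> C * (\<phi> y - \<phi> x)\<^sup>2"
    and P: "\<And>x. x \<in> {a..b} \<Longrightarrow> \<bar>P x - c\<bar> \<le> \<epsilon>"
  shows "\<bar>G b - G a - c * (b - a)\<bar> \<le> \<epsilon> * (b - a)"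
proof -
  have upper: "\<sigma> * (G b - G a) \<le> (\<sigma> * c + \<epsilon>) * (b - a)"
    if mono: "strict_mono_on {a..b} \<phi>" and cont: "continuous_on {a..b} \<phi>"
      and G: "\<And>x y. x \<in> {a..b} \<Longrightarrow> y \<in> {a..b} \<Longrightarrow> \<bar>G y - G x - P x * (y - x)\<bar> \<le> C * (\<phi> y - \<phi> x)\<^sup>2"
      and \<sigma>: "\<sigma> = 1 \<or> \<sigma> = - 1"
    for \<phi> :: "real \<Rightarrow> real" and \<sigma> :: real
  proof -
    have "\<exists>x\<in>{a..b}. \<phi> x = u" if "u \<in> {\<phi> a..\<phi> b}" for u
      using IVT'[of \<phi> a u b] that cont \<open>a \<le> b\<close> by auto
    then obtain X where X: "\<And>u. u \<in> {\<phi> a..\<phi> b} \<Longrightarrow> X u \<in> {a..b} \<and> \<phi> (X u) = u" by metis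
    have ab: "\<phi> a \<le> \<phi> b"
      using mono \<open>a \<le> b\<close> by (simp add: strict_mono_on_leD)
    have inj: "inj_on \<phi> {a..b}" using mono by (rule strict_mono_on_imp_inj_on)
    have Xab: "X (\<phi> a) = a" "X (\<phi> b) = b"
      using inj_onD[OF inj] X[of "\<phi> a"] X[of "\<phi> b"] ab \<open>a \<le> b\<close> by auto
    define k where "k u = \<sigma> * G (X u) - (\<sigma> * c + \<epsilon>) * X u" for u
    have "k (\<phi> b) \<le> k (\<phi> a)"
    proof (rule quadratic_increments_nonpos[OF ab, where C=C])
      fix u v assume uv: "\<phi> a \<le> u" "u \<le> v" "v \<le> \<phi> b"
      define x y where "x = X u" and "y = X v"
      have x: "x \<in> {a..b}" "\<phi> x = u" and y: "y \<in> {a..b}" "\<phi> y = v"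
        using X uv by (auto simp: x_def y_def)
      have "x \<le> y"
        using strict_mono_onD[OF mono y(1) x(1)] x y uv by (meson leD leI)
      have "k v - k u = \<sigma> * (G y - G x - P x * (y - x)) + (\<sigma> * (P x - c) - \<epsilon>) * (y - x)"
        by (simp add: k_def x_def y_def algebra_simps)
      moreover have "\<sigma> * (G y - G x - P x * (y - x)) \<le> C * (v - u)\<^sup>2"
        using G[OF x(1) y(1)] x y \<sigma> by auto
      moreover have "(\<sigma> * (P x - c) - \<epsilon>) * (y - x) \<le> 0"
        using P[OF x(1)] \<open>x \<le> y\<close> \<sigma> by (intro mult_nonpos_nonneg) auto
      ultimately show "k v - k u \<le> C * (v - u)\<^sup>2" by linarith
    qed
    then show ?thesis by (simp add: k_def Xab algebra_simps)
  qed
  have "strict_mono_on {a..b} \<phi> \<or> strict_antimono_on {a..b} \<phi>"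
    using injective_eq_monotone_map[OF _ cont] inj by (auto simp: is_interval_cc)
  then have "\<sigma> * (G b - G a) \<le> (\<sigma> * c + \<epsilon>) * (b - a)" if "\<sigma> = 1 \<or> \<sigma> = - 1" for \<sigma> :: real
  proof
    assume "strict_mono_on {a..b} \<phi>"
    then show ?thesis using cont G that by (rule upper)
  next
    assume *: "strict_antimono_on {a..b} \<phi>"
    show ?thesis
    proof (rule upper[where \<phi>="\<lambda>x. - \<phi> x", OF _ _ _ that])
      show "strict_mono_on {a..b} (\<lambda>x. - \<phi> x)"
        using * by (auto simp: monotone_on_def)
      show "continuous_on {a..b} (\<lambda>x. - \<phi> x)" using cont by (rule continuous_on_minus)
      fix x y assume "x \<in> {a..b}" "y \<in> {a..b}"
      moreover have "(- \<phi> y - - \<phi> x)\<^sup>2 = (\<phi> y - \<phi> x)\<^sup>2"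
        using power2_commute[of "\<phi> x" "\<phi> y"] by simp
      ultimately show "\<bar>G y - G x - P x * (y - x)\<bar> \<le> C * (- \<phi> y - - \<phi> x)\<^sup>2"
        using G by metis
    qed
  qed
  from this[of 1] this[of "- 1"]
  have "G b - G a \<le> c * (b - a) + \<epsilon> * (b - a)" "- (G b - G a) \<le> - c * (b - a) + \<epsilon> * (b - a)"
    unfolding distrib_right[symmetric] by simp_all
  then show ?thesis by linarith
qed

section \<open>The action of a continuous branch of trajectories\<close>

text \<open>The trajectory indexed by \<open>(x, t)\<close> runs from \<open>\<eta>\<^sub>0\<close> to \<open>x\<close> in time \<open>t\<close>. The last assumption says that
  trajectories with bounded initial momentum keep a bounded momentum and stay in a region where the
  force is under control.\<close>

locale trajectory_branch =
  fixes V f :: "real \<Rightarrow> real" and \<eta>\<^sub>0 :: real and D :: "(real \<times> real) set"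
    and e th :: "real \<Rightarrow> real \<Rightarrow> real \<Rightarrow> real"
  assumes open_D: "open D"
    and time_pos: "(x, t) \<in> D \<Longrightarrow> 0 < t"
    and traj: "(x, t) \<in> D \<Longrightarrow> trajectory f t (e x t) (th x t)"
    and start: "(x, t) \<in> D \<Longrightarrow> e x t 0 = \<eta>\<^sub>0"
    and finish: "(x, t) \<in> D \<Longrightarrow> e x t t = x"
    and cont: "continuous_on D (\<lambda>(x, t). th x t 0)"
    and confined: "\<exists>J M. lipschitz_force V f J M \<and>
      (\<forall>x t s. (x, t) \<in> D \<longrightarrow> \<bar>th x t 0\<bar> \<le> R \<longrightarrow> s \<in> {0..t} \<longrightarrow> e x t s \<in> J \<and> \<bar>th x t s\<bar> \<le> M)"
begin

abbreviation branch_action :: "real \<Rightarrow> real \<Rightarrow> real" where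
  "branch_action x t \<equiv> action V t (e x t) (th x t)"

lemma confinedE:
  obtains J M where "lipschitz_force V f J M"
    "\<And>x t s. (x, t) \<in> D \<Longrightarrow> \<bar>th x t 0\<bar> \<le> R \<Longrightarrow> s \<in> {0..t} \<Longrightarrow> e x t s \<in> J"
    "\<And>x t s. (x, t) \<in> D \<Longrightarrow> \<bar>th x t 0\<bar> \<le> R \<Longrightarrow> s \<in> {0..t} \<Longrightarrow> \<bar>th x t s\<bar> \<le> M"
  using confined[of R] by blast

text \<open>Uniqueness for the initial value problem, as the case \<open>\<delta> = 0\<close> of stability. It also compares
  trajectories of different duration, on the shorter time interval.\<close>

lemma start_momentum_determines:
  assumes xt: "(x, t) \<in> D" and yt: "(y, t') \<in> D" and "t \<le> t'"
    and eq: "th y t' 0 = th x t 0" and s: "s \<in> {0..t}"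
  shows "e y t' s = e x t s" "th y t' s = th x t s"
proof -
  obtain J M where L: "lipschitz_force V f J M"
    and J: "\<And>x' t' s. (x', t') \<in> D \<Longrightarrow> \<bar>th x' t' 0\<bar> \<le> \<bar>th x t 0\<bar> \<Longrightarrow> s \<in> {0..t'} \<Longrightarrow> e x' t' s \<in> J"
    using confinedE[of "\<bar>th x t 0\<bar>"] by metis
  have "(e y t' s - e x t s)\<^sup>2 + (th y t' s - th x t s)\<^sup>2
      \<le> exp ((4 + M) * t) * (th y t' 0 - th x t 0)\<^sup>2"
  proof (rule trajectory_stability[OF traj[OF xt] trajectory_restrict[OF traj[OF yt] \<open>t \<le> t'\<close>] _ _ L])
    show "e x t s \<in> J" if "s \<in> {0..t}" for s using J[OF xt _ that] by simp
    show "e y t' s \<in> J" if "s \<in> {0..t}" for s using J[OF yt] that \<open>t \<le> t'\<close> eq by auto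
    show "e y t' 0 = e x t 0" using start xt yt by simp
  qed (rule s)
  then have "(e y t' s - e x t s)\<^sup>2 + (th y t' s - th x t s)\<^sup>2 \<le> 0" by (simp add: eq)
  then show "e y t' s = e x t s" "th y t' s = th x t s"
    by (simp_all add: sum_power2_le_zero_iff)
qed

lemma start_momentum_inj: "inj_on (\<lambda>x. th x t 0) {x. (x, t) \<in> D}"
proof (rule inj_onI)
  fix x y assume xy: "x \<in> {x. (x, t) \<in> D}" "y \<in> {x. (x, t) \<in> D}" "th x t 0 = th y t 0"
  then have "e x t t = e y t t"
    using start_momentum_determines(1)[of y t x t t] time_pos[of x t] by simp
  then show "x = y" using xy finish by simp
qed

lemma continuous_start_momentum:
  assumes "continuous_on S g" "g ` S \<subseteq> D"
  shows "continuous_on S (\<lambda>s. th (fst (g s)) (snd (g s)) 0)"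
  using continuous_on_compose2[OF cont assms] by (simp add: case_prod_beta)

text \<open>One constant for all end data with bounded time and bounded initial momentum: the first
  variation of the action and the Lipschitz dependence of the final momentum.\<close>

lemma variation_estimates:
  obtains C where "0 \<le> C"
    "\<And>x y t. (x, t) \<in> D \<Longrightarrow> (y, t) \<in> D \<Longrightarrow> t \<le> T \<Longrightarrow> \<bar>th x t 0\<bar> \<le> R \<Longrightarrow> \<bar>th y t 0\<bar> \<le> R \<Longrightarrow>
       \<bar>branch_action y t - branch_action x t - th x t t * (y - x)\<bar> \<le> C * (th y t 0 - th x t 0)\<^sup>2"
    "\<And>x y t. (x, t) \<in> D \<Longrightarrow> (y, t) \<in> D \<Longrightarrow> t \<le> T \<Longrightarrow> \<bar>th x t 0\<bar> \<le> R \<Longrightarrow> \<bar>th y t 0\<bar> \<le> R \<Longrightarrow>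
       \<bar>th y t t - th x t t\<bar> \<le> C * \<bar>th y t 0 - th x t 0\<bar>"
proof -
  obtain J M where L: "lipschitz_force V f J M"
    and J: "\<And>x t s. (x, t) \<in> D \<Longrightarrow> \<bar>th x t 0\<bar> \<le> R \<Longrightarrow> s \<in> {0..t} \<Longrightarrow> e x t s \<in> J"
    using confinedE[of R] by metis
  note M = lipschitz_forceD(2)[OF L]
  define E where "E = exp ((4 + M) * \<bar>T\<bar>)"
  define C where "C = (2 + M) * E * (1 + \<bar>T\<bar>)"
  have E: "1 \<le> E" using M by (simp add: E_def)
  have "1 * E \<le> (2 + M) * E" using M E by (intro mult_right_mono) auto
  also have "(2 + M) * E * 1 \<le> C" unfolding C_def using M E by (intro mult_left_mono) auto
  finally have EC: "E \<le> C" by simp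
  show ?thesis
  proof (rule that[of C])
    show "0 \<le> C" using E EC by simp
    fix x y t assume D: "(x, t) \<in> D" "(y, t) \<in> D" and T: "t \<le> T" 
      and R: "\<bar>th x t 0\<bar> \<le> R" "\<bar>th y t 0\<bar> \<le> R"
    have t: "0 \<le> t" "t \<le> \<bar>T\<bar>" using time_pos[OF D(1)] T by auto
    have Et: "exp ((4 + M) * t) \<le> E" using t M by (simp add: E_def mult_left_mono)
    have init: "e y t 0 = e x t 0" using start D by simp
    have "\<bar>branch_action y t - branch_action x t - th x t t * (e y t t - e x t t)\<bar>
        \<le> (2 + M) * exp ((4 + M) * t) * t * (th y t 0 - th x t 0)\<^sup>2"
      by (rule action_first_variation[OF traj[OF D(1)] traj[OF D(2)] t(1) J[OF D(1) R(1)] J[OF D(2) R(2)] L init])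
    also have "\<dots> \<le> C * (th y t 0 - th x t 0)\<^sup>2"
      unfolding C_def using Et t M E by (intro mult_right_mono mult_mono) auto
    finally show "\<bar>branch_action y t - branch_action x t - th x t t * (y - x)\<bar> \<le> C * (th y t 0 - th x t 0)\<^sup>2"
      using finish D by simp
    have "(e y t t - e x t t)\<^sup>2 + (th y t t - th x t t)\<^sup>2 \<le> exp ((4 + M) * t) * (th y t 0 - th x t 0)\<^sup>2"
      by (rule trajectory_stability[OF traj[OF D(1)] traj[OF D(2)] J[OF D(1) R(1)] J[OF D(2) R(2)]
            L init]) (use t in auto)
    then have "(th y t t - th x t t)\<^sup>2 \<le> exp ((4 + M) * t) * (th y t 0 - th x t 0)\<^sup>2"
      using zero_le_power2[of "e y t t - e x t t"] by linarith
    also have "\<dots> \<le> C\<^sup>2 * (th y t 0 - th x t 0)\<^sup>2"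
    proof (rule mult_right_mono)
      have "exp ((4 + M) * t) \<le> C" using Et EC by simp
      also have "C \<le> C\<^sup>2" using E EC by (simp add: power2_eq_square)
      finally show "exp ((4 + M) * t) \<le> C\<^sup>2" .
    qed simp
    also have "\<dots> = (C * \<bar>th y t 0 - th x t 0\<bar>)\<^sup>2" by (simp add: power_mult_distrib)
    finally have "\<bar>th y t t - th x t t\<bar>\<^sup>2 \<le> (C * \<bar>th y t 0 - th x t 0\<bar>)\<^sup>2" by simp
    then show "\<bar>th y t t - th x t t\<bar> \<le> C * \<bar>th y t 0 - th x t 0\<bar>"
      by (rule power2_le_imp_le) (use E EC in auto)
  qed
qed

text \<open>Near \<open>\<eta>\<close> the initial momentum is an injective continuous parameter for the end points, so the
  first variation can be integrated along it; the final momentum varies by at most \<open>\<epsilon>\<close> there.\<close>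

lemma branch_action_endpoint_derivative:
  assumes D: "(\<eta>, t) \<in> D"
  shows "((\<lambda>x. branch_action x t) has_real_derivative th \<eta> t t) (at \<eta>)"
proof -
  let ?\<phi> = "\<lambda>x. th x t 0"
  obtain r where r: "0 < r" "cball (\<eta>, t) r \<subseteq> D"
    using open_D D open_contains_cball by blast
  let ?I = "{\<eta> - r..\<eta> + r}"
  have ID: "(x, t) \<in> D" if "x \<in> ?I" for x
    using that r(2) by (auto simp: subset_eq dist_Pair_Pair dist_real_def)
  have cont\<phi>: "continuous_on ?I ?\<phi>"
    using continuous_start_momentum[of ?I "\<lambda>x. (x, t)"] ID
    by (simp add: continuous_on_Pair image_subset_iff)
  have "bounded (?\<phi> ` ?I)"
    by (intro compact_imp_bounded compact_continuous_image cont\<phi> compact_Icc)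
  then obtain R where R: "\<And>x. x \<in> ?I \<Longrightarrow> \<bar>?\<phi> x\<bar> \<le> R"
    unfolding bounded_iff real_norm_def by blast
  obtain C where C: "0 \<le> C"
    "\<And>x y. (x, t) \<in> D \<Longrightarrow> (y, t) \<in> D \<Longrightarrow> \<bar>th x t 0\<bar> \<le> R \<Longrightarrow> \<bar>th y t 0\<bar> \<le> R \<Longrightarrow>
       \<bar>branch_action y t - branch_action x t - th x t t * (y - x)\<bar> \<le> C * (th y t 0 - th x t 0)\<^sup>2"
    "\<And>x y. (x, t) \<in> D \<Longrightarrow> (y, t) \<in> D \<Longrightarrow> \<bar>th x t 0\<bar> \<le> R \<Longrightarrow> \<bar>th y t 0\<bar> \<le> R \<Longrightarrow>
       \<bar>th y t t - th x t t\<bar> \<le> C * \<bar>th y t 0 - th x t 0\<bar>"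
    by (rule variation_estimates[where T=t and R=R]) blast
  have "\<exists>d>0. \<forall>x. \<bar>x - \<eta>\<bar> < d \<longrightarrow>
      \<bar>branch_action x t - branch_action \<eta> t - th \<eta> t t * (x - \<eta>)\<bar> \<le> \<epsilon> * \<bar>x - \<eta>\<bar>"
    if "0 < \<epsilon>" for \<epsilon>
  proof -
    have "0 < \<epsilon> / (C + 1)" using that C(1) by simp
    then obtain d where d: "0 < d"
      "\<And>x. x \<in> ?I \<Longrightarrow> \<bar>x - \<eta>\<bar> < d \<Longrightarrow> \<bar>?\<phi> x - ?\<phi> \<eta>\<bar> < \<epsilon> / (C + 1)"
      using cont\<phi> r(1) unfolding continuous_on_iff dist_real_def
      by (metis atLeastAtMost_iff add_increasing2 diff_le_eq less_imp_le order_refl)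
    have P: "\<bar>th x t t - th \<eta> t t\<bar> \<le> \<epsilon>" if "x \<in> ?I" "\<bar>x - \<eta>\<bar> < d" for x
    proof -
      have "\<bar>th x t t - th \<eta> t t\<bar> \<le> C * \<bar>?\<phi> x - ?\<phi> \<eta>\<bar>"
        using C(3)[OF D ID[OF that(1)]] R[OF that(1)] R[of \<eta>] r(1) by simp
      also have "\<dots> \<le> (C + 1) * (\<epsilon> / (C + 1))"
        using d(2)[OF that] C(1) by (intro mult_mono) auto
      also have "\<dots> = \<epsilon>" using C(1) by simp
      finally show ?thesis .
    qed
    have MV: "\<bar>branch_action b t - branch_action a t - th \<eta> t t * (b - a)\<bar> \<le> \<epsilon> * (b - a)"
      if ab: "a \<le> b" "{a..b} \<subseteq> ?I" "\<And>x. x \<in> {a..b} \<Longrightarrow> \<bar>x - \<eta>\<bar> < d" for a b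
    proof (rule mean_value_bound_monotone_parameter[OF ab(1), where \<phi>="?\<phi>" and C=C and P="\<lambda>x. th x t t"])
      show "continuous_on {a..b} ?\<phi>" using cont\<phi> ab(2) by (rule continuous_on_subset)
      show "inj_on ?\<phi> {a..b}"
        using start_momentum_inj[of t] by (rule inj_on_subset) (use ab(2) ID in blast)
      show "\<bar>branch_action y t - branch_action x t - th x t t * (y - x)\<bar> \<le> C * (?\<phi> y - ?\<phi> x)\<^sup>2"
        if "x \<in> {a..b}" "y \<in> {a..b}" for x y
        using C(2)[of x y] ID R that ab(2) by blast
      show "\<bar>th x t t - th \<eta> t t\<bar> \<le> \<epsilon>" if "x \<in> {a..b}" for x
        using P that ab(2,3) by blast
    qed
    show ?thesis
    proof (intro exI[of _ "min d r"] conjI allI impI)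
      show "0 < min d r" using d(1) r(1) by simp
      fix x assume x: "\<bar>x - \<eta>\<bar> < min d r"
      show "\<bar>branch_action x t - branch_action \<eta> t - th \<eta> t t * (x - \<eta>)\<bar> \<le> \<epsilon> * \<bar>x - \<eta>\<bar>"
      proof (cases "\<eta> \<le> x")
        case True
        then show ?thesis using MV[of \<eta> x] x by auto
      next
        case False
        then have "\<bar>branch_action \<eta> t - branch_action x t - th \<eta> t t * (\<eta> - x)\<bar> \<le> \<epsilon> * (\<eta> - x)"
          using x by (intro MV) auto
        moreover have "branch_action x t - branch_action \<eta> t - th \<eta> t t * (x - \<eta>)
          = - (branch_action \<eta> t - branch_action x t - th \<eta> t t * (\<eta> - x))"
          by (simp add: right_diff_distrib)
        ultimately show ?thesis using False by (simp only: abs_minus_cancel abs_of_neg) simp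
      qed
    qed
  qed
  then show ?thesis
    unfolding has_field_derivative_def has_derivative_at_alt
    by (auto intro: bounded_linear_mult_right)
qed

text \<open>The initial momentum that leads to \<open>\<eta>\<close> at time \<open>t\<^sub>2\<close> also occurs, for some end point \<open>x\<close> near \<open>\<eta>\<close>, at
  time \<open>t\<^sub>1\<close>. Since \<open>\<phi>(\<cdot>, t)\<close> is strictly monotone, \<open>\<phi>(\<eta> \<plusminus> \<rho>, t)\<close> lie on different sides of \<open>\<phi>(\<eta>, t)\<close>;
  by continuity this persists for times near \<open>t\<close>, and the intermediate value theorem gives \<open>x\<close>.\<close>

lemma nearby_times_share_start_momentum:
  assumes D: "(\<eta>, t) \<in> D" and \<epsilon>: "0 < \<epsilon>"
  obtains d where "0 < d"
    "\<And>t\<^sub>1 t\<^sub>2. \<bar>t\<^sub>1 - t\<bar> < d \<Longrightarrow> \<bar>t\<^sub>2 - t\<bar> < d \<Longrightarrow> (\<eta>, t\<^sub>2) \<in> D \<and> \<bar>th \<eta> t\<^sub>2 0 - th \<eta> t 0\<bar> \<le> \<epsilon> \<and>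
       (\<exists>x. th x t\<^sub>1 0 = th \<eta> t\<^sub>2 0 \<and>
         (\<forall>y\<in>closed_segment x \<eta>. (y, t\<^sub>1) \<in> D \<and> \<bar>th y t\<^sub>1 0 - th \<eta> t 0\<bar> \<le> \<epsilon>))"
proof -
  have "isCont (\<lambda>(x, t). th x t 0) (\<eta>, t)"
    using cont D open_D by (simp add: continuous_on_eq_continuous_at)
  then obtain r\<^sub>1 where r\<^sub>1: "0 < r\<^sub>1"
    "\<And>p. dist p (\<eta>, t) < r\<^sub>1 \<Longrightarrow> \<bar>th (fst p) (snd p) 0 - th \<eta> t 0\<bar> < \<epsilon>"
    unfolding continuous_at_eps_delta dist_real_def using \<epsilon> by (fastforce simp: case_prod_beta)
  obtain r\<^sub>2 where r\<^sub>2: "0 < r\<^sub>2" "ball (\<eta>, t) r\<^sub>2 \<subseteq> D"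
    using open_D D open_contains_ball by blast
  define \<rho> where "\<rho> = min r\<^sub>1 r\<^sub>2 / 3"
  have \<rho>: "0 < \<rho>" using r\<^sub>1 r\<^sub>2 by (simp add: \<rho>_def)
  have box: "(x, s) \<in> D \<and> \<bar>th x s 0 - th \<eta> t 0\<bar> \<le> \<epsilon>" if "\<bar>x - \<eta>\<bar> \<le> \<rho>" "\<bar>s - t\<bar> \<le> \<rho>" for x s
  proof -
    have "dist (x, s) (\<eta>, t) \<le> \<bar>x - \<eta>\<bar> + \<bar>s - t\<bar>"
      by (simp add: dist_Pair_Pair dist_real_def sqrt_sum_squares_le_sum_abs)
    also have "\<dots> < min r\<^sub>1 r\<^sub>2" using that \<rho> by (simp add: \<rho>_def)
    finally have "dist (x, s) (\<eta>, t) < r\<^sub>1" "(x, s) \<in> ball (\<eta>, t) r\<^sub>2"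
      by (simp_all add: dist_commute)
    then show ?thesis using r\<^sub>1(2)[of "(x, s)"] r\<^sub>2(2) by auto
  qed
  let ?I = "{\<eta> - \<rho>..\<eta> + \<rho>}"
  have cont_x: "continuous_on ?I (\<lambda>x. th x s 0)" if "\<bar>s - t\<bar> \<le> \<rho>" for s
    using continuous_start_momentum[of ?I "\<lambda>x. (x, s)"] box that
    by (force simp: continuous_on_Pair image_subset_iff)
  have cont_t: "((\<lambda>s. th x s 0) \<longlongrightarrow> th x t 0) (at t)" if "\<bar>x - \<eta>\<bar> \<le> \<rho>" for x
  proof -
    have "continuous_on {t - \<rho><..<t + \<rho>} (\<lambda>s. th x s 0)"
      using continuous_start_momentum[of "{t - \<rho><..<t + \<rho>}" "\<lambda>s. (x, s)"] box that
      by (force simp: continuous_on_Pair image_subset_iff)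
    then show ?thesis
      using \<rho> by (simp add: continuous_on_eq_continuous_at isCont_def)
  qed
  \<comment> \<open>Stated for a general \<open>\<psi>\<close> so that it covers increasing and decreasing initial momenta.\<close>
  have straddle: "\<exists>d>0. \<forall>t\<^sub>1 t\<^sub>2. \<bar>t\<^sub>1 - t\<bar> < d \<longrightarrow> \<bar>t\<^sub>2 - t\<bar> < d \<longrightarrow>
      (\<exists>x\<in>?I. \<psi> x t\<^sub>1 = \<psi> \<eta> t\<^sub>2)"
    if less: "\<psi> (\<eta> - \<rho>) t < \<psi> \<eta> t" "\<psi> \<eta> t < \<psi> (\<eta> + \<rho>) t"
      and \<psi>x: "\<And>s. \<bar>s - t\<bar> \<le> \<rho> \<Longrightarrow> continuous_on ?I (\<lambda>x. \<psi> x s)"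
      and \<psi>t: "\<And>x. \<bar>x - \<eta>\<bar> \<le> \<rho> \<Longrightarrow> (\<psi> x \<longlongrightarrow> \<psi> x t) (at t)"
    for \<psi> :: "real \<Rightarrow> real \<Rightarrow> real"
  proof -
    \<comment> \<open>Two fixed levels keep the three values apart for all nearby times simultaneously.\<close>
    obtain c\<^sub>1 c\<^sub>2 where c: "\<psi> (\<eta> - \<rho>) t < c\<^sub>1" "c\<^sub>1 < \<psi> \<eta> t" "\<psi> \<eta> t < c\<^sub>2" "c\<^sub>2 < \<psi> (\<eta> + \<rho>) t"
      using less dense by metis
    have "\<forall>\<^sub>F s in at t. \<psi> (\<eta> - \<rho>) s < c\<^sub>1" "\<forall>\<^sub>F s in at t. c\<^sub>2 < \<psi> (\<eta> + \<rho>) s"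
      "\<forall>\<^sub>F s in at t. c\<^sub>1 < \<psi> \<eta> s" "\<forall>\<^sub>F s in at t. \<psi> \<eta> s < c\<^sub>2"
      using order_tendstoD[OF \<psi>t[of "\<eta> - \<rho>"]] order_tendstoD[OF \<psi>t[of \<eta>]]
        order_tendstoD[OF \<psi>t[of "\<eta> + \<rho>"]] \<rho> c by simp_all
    then have "\<forall>\<^sub>F s in at t. \<psi> (\<eta> - \<rho>) s < c\<^sub>1 \<and> c\<^sub>2 < \<psi> (\<eta> + \<rho>) s \<and> c\<^sub>1 < \<psi> \<eta> s \<and> \<psi> \<eta> s < c\<^sub>2"
      by (intro eventually_conj)
    then obtain d where d: "0 < d" "\<And>s. s \<noteq> t \<Longrightarrow> \<bar>s - t\<bar> < d \<Longrightarrow>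
        \<psi> (\<eta> - \<rho>) s < c\<^sub>1 \<and> c\<^sub>2 < \<psi> (\<eta> + \<rho>) s \<and> c\<^sub>1 < \<psi> \<eta> s \<and> \<psi> \<eta> s < c\<^sub>2"
      unfolding eventually_at dist_real_def by blast
    have d': "\<psi> (\<eta> - \<rho>) s < c\<^sub>1 \<and> c\<^sub>2 < \<psi> (\<eta> + \<rho>) s \<and> c\<^sub>1 < \<psi> \<eta> s \<and> \<psi> \<eta> s < c\<^sub>2"
      if "\<bar>s - t\<bar> < d" for s
      using d(2)[OF _ that] c by (cases "s = t") auto
    show ?thesis
    proof (intro exI[of _ "min d \<rho>"] conjI allI impI)
      show "0 < min d \<rho>" using d(1) \<rho> by simp
      fix t\<^sub>1 t\<^sub>2 assume t: "\<bar>t\<^sub>1 - t\<bar> < min d \<rho>" "\<bar>t\<^sub>2 - t\<bar> < min d \<rho>"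
      have "\<exists>x\<ge>\<eta> - \<rho>. x \<le> \<eta> + \<rho> \<and> \<psi> x t\<^sub>1 = \<psi> \<eta> t\<^sub>2"
        using d'[of t\<^sub>1] d'[of t\<^sub>2] t \<rho> by (intro IVT' \<psi>x) auto
      then show "\<exists>x\<in>?I. \<psi> x t\<^sub>1 = \<psi> \<eta> t\<^sub>2" by auto
    qed
  qed
  have "inj_on (\<lambda>x. th x t 0) ?I"
    using start_momentum_inj[of t] by (rule inj_on_subset) (use box \<rho> in auto)
  then have "th (\<eta> - \<rho>) t 0 < th \<eta> t 0 \<and> th \<eta> t 0 < th (\<eta> + \<rho>) t 0 \<or>
      th (\<eta> + \<rho>) t 0 < th \<eta> t 0 \<and> th \<eta> t 0 < th (\<eta> - \<rho>) t 0"
    using continuous_inj_imp_mono[of "\<eta> - \<rho>" \<eta> "\<eta> + \<rho>" "\<lambda>x. th x t 0"] cont_x[of t] \<rho> by simp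
  then have "\<exists>d>0. \<forall>t\<^sub>1 t\<^sub>2. \<bar>t\<^sub>1 - t\<bar> < d \<longrightarrow> \<bar>t\<^sub>2 - t\<bar> < d \<longrightarrow>
      (\<exists>x\<in>?I. th x t\<^sub>1 0 = th \<eta> t\<^sub>2 0)"
  proof
    assume "th (\<eta> - \<rho>) t 0 < th \<eta> t 0 \<and> th \<eta> t 0 < th (\<eta> + \<rho>) t 0"
    then show ?thesis
      using straddle[of "\<lambda>x s. th x s 0"] cont_x cont_t by blast
  next
    assume "th (\<eta> + \<rho>) t 0 < th \<eta> t 0 \<and> th \<eta> t 0 < th (\<eta> - \<rho>) t 0"
    then show ?thesis
      using straddle[of "\<lambda>x s. - th x s 0"] cont_x cont_t
      by (simp add: continuous_on_minus tendsto_minus)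
  qed
  then obtain d where d: "0 < d" "\<And>t\<^sub>1 t\<^sub>2. \<bar>t\<^sub>1 - t\<bar> < d \<Longrightarrow> \<bar>t\<^sub>2 - t\<bar> < d \<Longrightarrow>
      \<exists>x\<in>?I. th x t\<^sub>1 0 = th \<eta> t\<^sub>2 0" by blast
  show ?thesis
  proof (rule that[of "min d \<rho>"])
    show "0 < min d \<rho>" using d(1) \<rho> by simp
    fix t\<^sub>1 t\<^sub>2 assume t: "\<bar>t\<^sub>1 - t\<bar> < min d \<rho>" "\<bar>t\<^sub>2 - t\<bar> < min d \<rho>"
    then obtain x where x: "x \<in> ?I" "th x t\<^sub>1 0 = th \<eta> t\<^sub>2 0" using d(2)[of t\<^sub>1 t\<^sub>2] by auto
    have "\<bar>y - \<eta>\<bar> \<le> \<rho>" if "y \<in> closed_segment x \<eta>" for y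
      using that x(1) by (auto simp: closed_segment_eq_real_ivl split: if_splits)
    then show "(\<eta>, t\<^sub>2) \<in> D \<and> \<bar>th \<eta> t\<^sub>2 0 - th \<eta> t 0\<bar> \<le> \<epsilon> \<and>
       (\<exists>x. th x t\<^sub>1 0 = th \<eta> t\<^sub>2 0 \<and>
         (\<forall>y\<in>closed_segment x \<eta>. (y, t\<^sub>1) \<in> D \<and> \<bar>th y t\<^sub>1 0 - th \<eta> t 0\<bar> \<le> \<epsilon>))"
      using box t x(2) \<rho> by (intro conjI exI[of _ x] ballI) auto
  qed
qed

text \<open>The increment of \<open>W\<close> from \<open>(\<eta>, t\<^sub>1)\<close> to \<open>(\<eta>, t\<^sub>2)\<close> is taken through \<open>(x, t\<^sub>1)\<close>, where \<open>x\<close> is the position at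
  time \<open>t\<^sub>1\<close> of the trajectory that ends in \<open>\<eta>\<close> at time \<open>t\<^sub>2\<close>. The first leg is the end point derivative
  at fixed time, the second leg is the same trajectory run longer. On both legs the momentum is
  within \<open>\<delta>\<close> of \<open>p\<close>, so the increment is \<open>(2p\<^sup>2 - V(\<eta>)) - p \<cdot> 4p\<close> per unit of time, up to a multiple
  of \<open>\<delta>\<close>. One of the two times is \<open>t\<close>; this is how the momenta are tied to \<open>p\<close>.\<close>

lemma branch_action_two_times:
  assumes D: "(\<eta>, t) \<in> D" and \<kappa>: "0 < \<kappa>"
  defines "p \<equiv> th \<eta> t t"
  shows "\<exists>d>0. \<forall>t\<^sub>1 t\<^sub>2. t\<^sub>1 < t\<^sub>2 \<longrightarrow> \<bar>t\<^sub>1 - t\<bar> < d \<longrightarrow> \<bar>t\<^sub>2 - t\<bar> < d \<longrightarrow> t\<^sub>1 = t \<or> t\<^sub>2 = t \<longrightarrow>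
    \<bar>branch_action \<eta> t\<^sub>2 - branch_action \<eta> t\<^sub>1 + (2 * p\<^sup>2 + V \<eta>) * (t\<^sub>2 - t\<^sub>1)\<bar> \<le> \<kappa> * (t\<^sub>2 - t\<^sub>1)"
proof -
  define R where "R = \<bar>th \<eta> t 0\<bar> + 1"
  obtain J M where L: "lipschitz_force V f J M"
    and J: "\<And>x t s. (x, t) \<in> D \<Longrightarrow> \<bar>th x t 0\<bar> \<le> R \<Longrightarrow> s \<in> {0..t} \<Longrightarrow> e x t s \<in> J"
    and th_le: "\<And>x t s. (x, t) \<in> D \<Longrightarrow> \<bar>th x t 0\<bar> \<le> R \<Longrightarrow> s \<in> {0..t} \<Longrightarrow> \<bar>th x t s\<bar> \<le> M"
    by (rule confinedE[of R]) blast
  note M = lipschitz_forceD(2)[OF L]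
  have cV: "continuous_on J V" using lipschitz_forceD(3)[OF L] by (rule DERIV_continuous_on)
  obtain C where C: "0 \<le> C"
    "\<And>x y s. (x, s) \<in> D \<Longrightarrow> (y, s) \<in> D \<Longrightarrow> s \<le> t + 1 \<Longrightarrow> \<bar>th x s 0\<bar> \<le> R \<Longrightarrow> \<bar>th y s 0\<bar> \<le> R \<Longrightarrow>
       \<bar>th y s s - th x s s\<bar> \<le> C * \<bar>th y s 0 - th x s 0\<bar>"
    by (rule variation_estimates[where T="t + 1" and R=R]) blast
  \<comment> \<open>The errors of the two legs add up to \<open>(1 + 12 M) \<delta>\<close> per unit of time.\<close>
  define \<delta> where "\<delta> = \<kappa> / (1 + 12 * M)"
  have \<delta>: "0 < \<delta>" "(1 + 12 * M) * \<delta> = \<kappa>" using \<kappa> M by (simp_all add: \<delta>_def)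
  define \<epsilon> where "\<epsilon> = min 1 (\<delta> / (8 * (C + 1)))"
  have \<epsilon>: "0 < \<epsilon>" "\<epsilon> \<le> 1" using \<delta> C(1) by (simp_all add: \<epsilon>_def)
  have "C * (2 * \<epsilon>) \<le> (C + 1) * (2 * (\<delta> / (8 * (C + 1))))"
    using C(1) \<epsilon> by (intro mult_mono) (simp_all add: \<epsilon>_def)
  also have "\<dots> = \<delta> / 4" using C(1) by (simp add: field_simps)
  finally have C\<epsilon>: "C * (2 * \<epsilon>) \<le> \<delta> / 4" .
  obtain d\<^sub>0 where d\<^sub>0: "0 < d\<^sub>0"
    "\<And>t\<^sub>1 t\<^sub>2. \<bar>t\<^sub>1 - t\<bar> < d\<^sub>0 \<Longrightarrow> \<bar>t\<^sub>2 - t\<bar> < d\<^sub>0 \<Longrightarrow> (\<eta>, t\<^sub>2) \<in> D \<and> \<bar>th \<eta> t\<^sub>2 0 - th \<eta> t 0\<bar> \<le> \<epsilon> \<and>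
       (\<exists>x. th x t\<^sub>1 0 = th \<eta> t\<^sub>2 0 \<and>
         (\<forall>y\<in>closed_segment x \<eta>. (y, t\<^sub>1) \<in> D \<and> \<bar>th y t\<^sub>1 0 - th \<eta> t 0\<bar> \<le> \<epsilon>))"
    using nearby_times_share_start_momentum[OF D \<epsilon>(1)] by metis
  \<comment> \<open>The last two entries bound the change of momentum and of potential within time \<open>d\<close>.\<close>
  define d where "d = Min {d\<^sub>0, 1, \<delta> / (4 * (M + 1)), \<delta> / (4 * (M\<^sup>2 + 1))}"
  have d: "0 < d" "d \<le> d\<^sub>0" "d \<le> 1" "d \<le> \<delta> / (4 * (M + 1))" "d \<le> \<delta> / (4 * (M\<^sup>2 + 1))"
    using d\<^sub>0(1) \<delta> M by (auto simp: d_def intro!: divide_pos_pos add_nonneg_pos)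
  have "M * d \<le> (M + 1) * (\<delta> / (4 * (M + 1)))"
    using M d by (intro mult_mono) auto
  also have "\<dots> = \<delta> / 4" using M by (simp add: field_simps)
  finally have Md: "M * d \<le> \<delta> / 4" .
  have "M\<^sup>2 * d \<le> (M\<^sup>2 + 1) * (\<delta> / (4 * (M\<^sup>2 + 1)))"
    using M d by (intro mult_mono) auto
  also have "M\<^sup>2 + 1 \<noteq> 0" using zero_le_power2[of M] by linarith
  then have "(M\<^sup>2 + 1) * (\<delta> / (4 * (M\<^sup>2 + 1))) = \<delta> / 4" by (simp add: field_simps)
  finally have MMd: "M\<^sup>2 * d \<le> \<delta> / 4" .
  show ?thesis
  proof (intro exI[of _ d] conjI allI impI)
    show "0 < d" by (rule d(1))
    fix t\<^sub>1 t\<^sub>2 assume t12: "t\<^sub>1 < t\<^sub>2" and near: "\<bar>t\<^sub>1 - t\<bar> < d" "\<bar>t\<^sub>2 - t\<bar> < d" and or: "t\<^sub>1 = t \<or> t\<^sub>2 = t"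
    have "\<bar>t\<^sub>1 - t\<bar> < d\<^sub>0" "\<bar>t\<^sub>2 - t\<bar> < d\<^sub>0" using near d by auto
    from d\<^sub>0(2)[OF this] obtain x where D2: "(\<eta>, t\<^sub>2) \<in> D" and \<phi>2: "\<bar>th \<eta> t\<^sub>2 0 - th \<eta> t 0\<bar> \<le> \<epsilon>"
      and x: "th x t\<^sub>1 0 = th \<eta> t\<^sub>2 0"
      and seg: "\<And>y. y \<in> closed_segment x \<eta> \<Longrightarrow> (y, t\<^sub>1) \<in> D"
        "\<And>y. y \<in> closed_segment x \<eta> \<Longrightarrow> \<bar>th y t\<^sub>1 0 - th \<eta> t 0\<bar> \<le> \<epsilon>" by blast
    have Dx: "(x, t\<^sub>1) \<in> D" and D1: "(\<eta>, t\<^sub>1) \<in> D" using seg(1) by simp_all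
    have pos: "0 < t\<^sub>1" using time_pos[OF D1] .
    have R2: "\<bar>th \<eta> t\<^sub>2 0\<bar> \<le> R" and Rt: "\<bar>th \<eta> t 0\<bar> \<le> R"
      and Rseg: "\<And>y. y \<in> closed_segment x \<eta> \<Longrightarrow> \<bar>th y t\<^sub>1 0\<bar> \<le> R"
      using \<phi>2 seg(2) \<epsilon> unfolding R_def by fastforce+
    have p: "\<bar>p\<bar> \<le> M" unfolding p_def using th_le[OF D Rt] time_pos[OF D] by simp
    let ?E = "e \<eta> t\<^sub>2" and ?P = "th \<eta> t\<^sub>2" and ?\<Delta> = "t\<^sub>2 - t\<^sub>1"
    note T2 = traj[OF D2]
    have same: "e x t\<^sub>1 s = ?E s" "th x t\<^sub>1 s = ?P s" if "s \<in> {0..t\<^sub>1}" for s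
      using start_momentum_determines[OF Dx D2 less_imp_le[OF t12] x[symmetric] that] by simp_all
    have x_eq: "x = ?E t\<^sub>1" using same(1)[of t\<^sub>1] finish[OF Dx] pos by simp
    have sub: "{t\<^sub>1..t\<^sub>2} \<subseteq> {0..t\<^sub>2}" using pos by auto
    have dist2: "\<bar>s - s'\<bar> \<le> d" if "s \<in> {t\<^sub>1..t\<^sub>2}" "s' \<in> {t\<^sub>1..t\<^sub>2}" for s s'
      using that near or by auto
    have P_var: "\<bar>?P s - ?P s'\<bar> \<le> \<delta> / 4" if s: "s \<in> {t\<^sub>1..t\<^sub>2}" "s' \<in> {t\<^sub>1..t\<^sub>2}" for s s'
    proof -
      have "norm (?P s - ?P s') \<le> M * norm (s - s')"
      proof (rule field_differentiable_bound[where S="{0..t\<^sub>2}" and f'="\<lambda>s. - f (?E s)"])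
        fix s assume s: "s \<in> {0..t\<^sub>2}"
        show "(?P has_real_derivative - f (?E s)) (at s within {0..t\<^sub>2})" by (rule trajectoryD[OF T2 s])
        show "norm (- f (?E s)) \<le> M" using lipschitz_forceD(4)[OF L J[OF D2 R2 s]] by simp
      qed (use s sub in auto)
      also have "\<dots> \<le> M * d" using dist2[OF s] M by (intro mult_left_mono) simp_all
      finally show ?thesis using Md by simp
    qed
    have Pseg: "\<bar>th y t\<^sub>1 t\<^sub>1 - ?P t\<^sub>1\<bar> \<le> \<delta> / 4" if y: "y \<in> closed_segment x \<eta>" for y
    proof -
      have "\<bar>th y t\<^sub>1 t\<^sub>1 - th x t\<^sub>1 t\<^sub>1\<bar> \<le> C * \<bar>th y t\<^sub>1 0 - th x t\<^sub>1 0\<bar>"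
        using C(2)[OF Dx seg(1)[OF y] _ Rseg Rseg[OF y]] near d by simp
      also have "\<dots> \<le> C * (2 * \<epsilon>)"
        using seg(2)[OF y] \<phi>2 x C(1) by (intro mult_left_mono) auto
      finally show ?thesis using C\<epsilon> same(2)[of t\<^sub>1] pos by simp
    qed
    \<comment> \<open>If \<open>t\<^sub>2 = t\<close> this is trivial. If \<open>t\<^sub>1 = t\<close>, then \<open>p\<close> is the final momentum of the branch at
      \<open>(\<eta>, t\<^sub>1)\<close>, which is close to the one at \<open>(x, t\<^sub>1)\<close>.\<close>
    have P2: "\<bar>?P t\<^sub>2 - p\<bar> \<le> \<delta> / 2"
      using or
    proof
      assume "t\<^sub>1 = t"
      then have "\<bar>p - ?P t\<^sub>1\<bar> \<le> \<delta> / 4" using Pseg[of \<eta>] by (simp add: p_def)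
      moreover have "\<bar>?P t\<^sub>1 - ?P t\<^sub>2\<bar> \<le> \<delta> / 4" using P_var[of t\<^sub>1 t\<^sub>2] t12 by simp
      ultimately show ?thesis by linarith
    qed (use \<delta> p_def in simp)
    have P_near: "\<bar>?P s - p\<bar> \<le> 3 * \<delta> / 4" if "s \<in> {t\<^sub>1..t\<^sub>2}" for s
    proof -
      have "\<bar>?P s - ?P t\<^sub>2\<bar> \<le> \<delta> / 4" using P_var[OF that, of t\<^sub>2] t12 by simp
      then show ?thesis using P2 by linarith
    qed
    have Pseg_near: "\<bar>th y t\<^sub>1 t\<^sub>1 - p\<bar> \<le> \<delta>" if "y \<in> closed_segment x \<eta>" for y
    proof -
      have "\<bar>?P t\<^sub>1 - p\<bar> \<le> 3 * \<delta> / 4" using P_near[of t\<^sub>1] t12 by simp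
      then show ?thesis using Pseg[OF that] by linarith
    qed
    have E_der: "(?E has_real_derivative 4 * ?P s) (at s within {t\<^sub>1..t\<^sub>2})" if "s \<in> {t\<^sub>1..t\<^sub>2}" for s
      using trajectoryD(1)[OF T2, of s] that sub by (blast intro: DERIV_subset)
    have V_near: "\<bar>V (?E s) - V \<eta>\<bar> \<le> \<delta>" if s: "s \<in> {t\<^sub>1..t\<^sub>2}" for s
    proof -
      have "norm (?E s - ?E t\<^sub>2) \<le> (4 * M) * norm (s - t\<^sub>2)"
      proof (rule field_differentiable_bound[OF _ E_der])
        fix s assume "s \<in> {t\<^sub>1..t\<^sub>2}"
        then show "norm (4 * ?P s) \<le> 4 * M" using th_le[OF D2 R2, of s] sub by (auto simp: abs_mult)
      qed (use s in auto)
      also have "\<dots> \<le> (4 * M) * d" using dist2[OF s, of t\<^sub>2] t12 M by (intro mult_left_mono) simp_all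
      finally have E: "\<bar>?E s - \<eta>\<bar> \<le> 4 * M * d" using finish[OF D2] by simp
      have "norm (V (?E s) - V (?E t\<^sub>2)) \<le> M * norm (?E s - ?E t\<^sub>2)"
      proof (rule field_differentiable_bound[OF lipschitz_forceD(1)[OF L] lipschitz_forceD(3)[OF L]])
        show "?E s \<in> J" "?E t\<^sub>2 \<in> J" using J[OF D2 R2] s sub t12 by auto
      qed (use lipschitz_forceD(4)[OF L] in simp_all)
      then have "\<bar>V (?E s) - V \<eta>\<bar> \<le> M * \<bar>?E s - \<eta>\<bar>" using finish[OF D2] by simp
      also have "\<dots> \<le> M * (4 * M * d)" using E M by (rule mult_left_mono)
      also have "\<dots> \<le> \<delta>" using MMd by (simp add: power2_eq_square)
      finally show ?thesis .
    qed
    have endpoint: "\<bar>(\<eta> - x) - 4 * p * ?\<Delta>\<bar> \<le> 4 * \<delta> * ?\<Delta>" (is "\<bar>?a\<bar> \<le> _")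
    proof -
      let ?g = "\<lambda>s. ?E s - 4 * p * s"
      have "norm (?g t\<^sub>2 - ?g t\<^sub>1) \<le> (4 * \<delta>) * norm (t\<^sub>2 - t\<^sub>1)"
      proof (rule field_differentiable_bound[where S="{t\<^sub>1..t\<^sub>2}" and f="?g" and f'="\<lambda>s. 4 * ?P s - 4 * p"])
        fix s assume s: "s \<in> {t\<^sub>1..t\<^sub>2}"
        show "(?g has_real_derivative 4 * ?P s - 4 * p) (at s within {t\<^sub>1..t\<^sub>2})"
          by (rule derivative_eq_intros refl E_der[OF s])+ simp
        show "norm (4 * ?P s - 4 * p) \<le> 4 * \<delta>" using P_near[OF s] \<delta>(1) unfolding real_norm_def by linarith
      qed (use t12 in auto)
      then show ?thesis using t12 x_eq finish[OF D2] by (simp add: algebra_simps)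
    qed
    have endpoint': "\<bar>\<eta> - x\<bar> \<le> 4 * M * ?\<Delta>"
    proof -
      have "norm (?E t\<^sub>2 - ?E t\<^sub>1) \<le> (4 * M) * norm (t\<^sub>2 - t\<^sub>1)"
      proof (rule field_differentiable_bound[OF _ E_der])
        fix s assume "s \<in> {t\<^sub>1..t\<^sub>2}"
        then show "norm (4 * ?P s) \<le> 4 * M" using th_le[OF D2 R2, of s] sub by (auto simp: abs_mult)
      qed (use t12 in auto)
      then show ?thesis using t12 x_eq finish[OF D2] by simp
    qed
    have moved_end: "\<bar>branch_action \<eta> t\<^sub>1 - branch_action x t\<^sub>1 - p * (\<eta> - x)\<bar> \<le> \<delta> * \<bar>\<eta> - x\<bar>" (is "\<bar>?b\<bar> \<le> _")
    proof -
      let ?g = "\<lambda>y. branch_action y t\<^sub>1 - p * y"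
      have "norm (?g \<eta> - ?g x) \<le> \<delta> * norm (\<eta> - x)"
      proof (rule field_differentiable_bound[where S="closed_segment x \<eta>" and f="?g" and f'="\<lambda>y. th y t\<^sub>1 t\<^sub>1 - p"])
        fix y assume y: "y \<in> closed_segment x \<eta>"
        have "((\<lambda>y. branch_action y t\<^sub>1) has_real_derivative th y t\<^sub>1 t\<^sub>1) (at y within closed_segment x \<eta>)"
          by (rule has_field_derivative_at_within[OF branch_action_endpoint_derivative[OF seg(1)[OF y]]])
        from DERIV_diff[OF this DERIV_cmult[OF DERIV_ident, of p]]
        show "(?g has_real_derivative th y t\<^sub>1 t\<^sub>1 - p) (at y within closed_segment x \<eta>)" by simp
        show "norm (th y t\<^sub>1 t\<^sub>1 - p) \<le> \<delta>" using Pseg_near[OF y] by simp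
      qed auto
      then show ?thesis by (simp add: algebra_simps)
    qed
    have longer_time: "\<bar>branch_action \<eta> t\<^sub>2 - branch_action x t\<^sub>1 - (2 * p\<^sup>2 - V \<eta>) * ?\<Delta>\<bar> \<le> (1 + 4 * M) * \<delta> * ?\<Delta>" (is "\<bar>?c\<bar> \<le> _")
    proof -
      have Wx: "branch_action x t\<^sub>1 = action V t\<^sub>1 ?E ?P"
        unfolding action_def using same by (intro integral_cong) simp
      let ?g = "\<lambda>s. action V s ?E ?P - (2 * p\<^sup>2 - V \<eta>) * s"
      let ?g' = "\<lambda>s. 2 * (?P s)\<^sup>2 - V (?E s) - (2 * p\<^sup>2 - V \<eta>)"
      have "norm (?g t\<^sub>2 - ?g t\<^sub>1) \<le> ((1 + 4 * M) * \<delta>) * norm (t\<^sub>2 - t\<^sub>1)"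
      proof (rule field_differentiable_bound[where S="{t\<^sub>1..t\<^sub>2}" and f="?g" and f'="?g'"])
        fix s assume s: "s \<in> {t\<^sub>1..t\<^sub>2}"
        then have s2: "s \<in> {0..t\<^sub>2}" using sub by blast
        have "((\<lambda>s. action V s ?E ?P) has_real_derivative 2 * (?P s)\<^sup>2 - V (?E s)) (at s within {t\<^sub>1..t\<^sub>2})"
          by (rule DERIV_subset[OF action_has_derivative[OF T2 J[OF D2 R2] cV s2] sub])
        from DERIV_diff[OF this DERIV_cmult[OF DERIV_ident, of "2 * p\<^sup>2 - V \<eta>"]]
        show "(?g has_real_derivative ?g' s) (at s within {t\<^sub>1..t\<^sub>2})" by simp
        have "\<bar>(?P s)\<^sup>2 - p\<^sup>2\<bar> = \<bar>?P s + p\<bar> * \<bar>?P s - p\<bar>"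
          by (simp add: power2_eq_square abs_mult[symmetric] square_diff_square_factored del: abs_mult)
        also have "\<dots> \<le> (2 * M) * \<delta>"
          using P_near[OF s] \<delta>(1) th_le[OF D2 R2 s2] p M by (intro mult_mono) auto
        finally show "norm (?g' s) \<le> (1 + 4 * M) * \<delta>"
          using V_near[OF s] by (simp add: algebra_simps)
      qed (use t12 in auto)
      then show ?thesis using t12 by (simp add: Wx algebra_simps)
    qed
    \<comment> \<open>The sum of both legs; \<open>\<eta> - x\<close> is \<open>4p\<close> times the elapsed time, up to \<open>?a\<close>.\<close>
    have "\<delta> * \<bar>\<eta> - x\<bar> \<le> \<delta> * (4 * M * ?\<Delta>)" using endpoint' \<delta>(1) by (intro mult_left_mono) auto
    moreover have "\<bar>p * ?a\<bar> \<le> M * (4 * \<delta> * ?\<Delta>)"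
      unfolding abs_mult using endpoint p M by (intro mult_mono) auto
    moreover have "branch_action \<eta> t\<^sub>2 - branch_action \<eta> t\<^sub>1 + (2 * p\<^sup>2 + V \<eta>) * ?\<Delta> = ?c - ?b - p * ?a"
      by (simp add: power2_eq_square algebra_simps)
    ultimately have "\<bar>branch_action \<eta> t\<^sub>2 - branch_action \<eta> t\<^sub>1 + (2 * p\<^sup>2 + V \<eta>) * ?\<Delta>\<bar>
        \<le> (1 + 4 * M) * \<delta> * ?\<Delta> + \<delta> * (4 * M * ?\<Delta>) + M * (4 * \<delta> * ?\<Delta>)"
      using moved_end longer_time by linarith
    also have "\<dots> = (1 + 12 * M) * \<delta> * ?\<Delta>" by (simp add: algebra_simps)
    finally show "\<bar>branch_action \<eta> t\<^sub>2 - branch_action \<eta> t\<^sub>1 + (2 * p\<^sup>2 + V \<eta>) * ?\<Delta>\<bar> \<le> \<kappa> * ?\<Delta>"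
      unfolding \<delta>(2) .
  qed
qed

lemma branch_action_time_derivative:
  assumes D: "(\<eta>, t) \<in> D"
  shows "((\<lambda>s. branch_action \<eta> s) has_real_derivative - (2 * (th \<eta> t t)\<^sup>2 + V \<eta>)) (at t)"
proof -
  let ?W = "branch_action \<eta>"
  define H where "H = 2 * (th \<eta> t t)\<^sup>2 + V \<eta>"
  have "\<exists>d>0. \<forall>s. \<bar>s - t\<bar> < d \<longrightarrow> \<bar>?W s - ?W t - - H * (s - t)\<bar> \<le> \<kappa> * \<bar>s - t\<bar>"
    if \<kappa>: "0 < \<kappa>" for \<kappa>
  proof -
    obtain d where d: "0 < d" "\<And>t\<^sub>1 t\<^sub>2. t\<^sub>1 < t\<^sub>2 \<Longrightarrow> \<bar>t\<^sub>1 - t\<bar> < d \<Longrightarrow> \<bar>t\<^sub>2 - t\<bar> < d \<Longrightarrow> t\<^sub>1 = t \<or> t\<^sub>2 = t \<Longrightarrow>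
        \<bar>?W t\<^sub>2 - ?W t\<^sub>1 + H * (t\<^sub>2 - t\<^sub>1)\<bar> \<le> \<kappa> * (t\<^sub>2 - t\<^sub>1)"
      using branch_action_two_times[OF D \<kappa>] unfolding H_def by blast
    show ?thesis
    proof (intro exI[of _ d] conjI allI impI)
      fix s assume s: "\<bar>s - t\<bar> < d"
      consider "s < t" | "s = t" | "t < s" by linarith
      then show "\<bar>?W s - ?W t - - H * (s - t)\<bar> \<le> \<kappa> * \<bar>s - t\<bar>"
      proof cases
        case 1
        have "?W s - ?W t - - H * (s - t) = - (?W t - ?W s + H * (t - s))"
          by (simp add: algebra_simps)
        moreover have "\<kappa> * \<bar>s - t\<bar> = \<kappa> * (t - s)" using 1 by simp
        ultimately show ?thesis using d(2)[OF 1 s] d(1) by (simp only: abs_minus_cancel) simp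
      next
        case 3
        then show ?thesis using d(2)[OF 3 _ s] d(1) by simp
      qed simp
    qed (rule d(1))
  qed
  then show ?thesis
    unfolding has_field_derivative_def has_derivative_at_alt H_def[symmetric]
    by (auto intro: bounded_linear_mult_right)
qed

end

section \<open>The radial part of the Hamiltonian system\<close>

definition radial_potential :: "real \<Rightarrow> real \<Rightarrow> real \<Rightarrow> real" where
  "radial_potential \<psi>\<^sub>1 \<psi>\<^sub>2 x = \<psi>\<^sub>1\<^sup>2 / 2 * (tan x)\<^sup>2 + \<psi>\<^sub>2\<^sup>2 / 2 * (cot x)\<^sup>2 + \<psi>\<^sub>1 * \<psi>\<^sub>2"

definition radial_force :: "real \<Rightarrow> real \<Rightarrow> real \<Rightarrow> real" where
  "radial_force \<psi>\<^sub>1 \<psi>\<^sub>2 x = \<psi>\<^sub>1\<^sup>2 * (tan x / (cos x)\<^sup>2) - \<psi>\<^sub>2\<^sup>2 * (cot x / (sin x)\<^sup>2)"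

lemma Ham_eq_radial: "Ham \<zeta>\<^sub>1 \<zeta>\<^sub>2 \<eta> \<psi>\<^sub>1 \<psi>\<^sub>2 \<theta> = 2 * \<theta>\<^sup>2 + radial_potential \<psi>\<^sub>1 \<psi>\<^sub>2 \<eta>"
  by (simp add: Ham_def radial_potential_def field_simps)

lemma tan_cot_derivatives:
  fixes x :: real
  assumes "0 < x" "x < pi / 2"
  shows "(tan has_real_derivative 1 + (tan x)\<^sup>2) (at x)"
    and "(cot has_real_derivative - (1 + (cot x)\<^sup>2)) (at x)"
    and "tan x / (cos x)\<^sup>2 = tan x * (1 + (tan x)\<^sup>2)"
    and "cot x / (sin x)\<^sup>2 = cot x * (1 + (cot x)\<^sup>2)"
proof -
  have nz: "cos x \<noteq> 0" "sin x \<noteq> 0"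
    using cos_gt_zero[of x] sin_gt_zero[of x] assms by auto
  have T: "1 + (tan x)\<^sup>2 = inverse ((cos x)\<^sup>2)" and C: "1 + (cot x)\<^sup>2 = inverse ((sin x)\<^sup>2)"
    using nz sin_cos_squared_add[of x] by (simp_all add: tan_def cot_def divide_simps)
  show "(tan has_real_derivative 1 + (tan x)\<^sup>2) (at x)" "(cot has_real_derivative - (1 + (cot x)\<^sup>2)) (at x)"
    unfolding T C using DERIV_tan[OF nz(1)] DERIV_cot[OF nz(2)] by simp_all
  show "tan x / (cos x)\<^sup>2 = tan x * (1 + (tan x)\<^sup>2)" "cot x / (sin x)\<^sup>2 = cot x * (1 + (cot x)\<^sup>2)"
    unfolding T C by (simp_all add: divide_inverse)
qed

lemma radial_force_eq:
  assumes "0 < x" "x < pi / 2"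
  shows "radial_force \<psi>\<^sub>1 \<psi>\<^sub>2 x = \<psi>\<^sub>1\<^sup>2 * (tan x * (1 + (tan x)\<^sup>2)) - \<psi>\<^sub>2\<^sup>2 * (cot x * (1 + (cot x)\<^sup>2))"
  using tan_cot_derivatives(3,4)[OF assms] by (simp add: radial_force_def)

lemma radial_potential_derivative:
  assumes "0 < x" "x < pi / 2"
  shows "(radial_potential \<psi>\<^sub>1 \<psi>\<^sub>2 has_real_derivative radial_force \<psi>\<^sub>1 \<psi>\<^sub>2 x) (at x)"
  unfolding radial_potential_def[abs_def] radial_force_eq[OF assms]
  by (rule tan_cot_derivatives(1,2)[OF assms] derivative_eq_intros refl)+
     (simp add: power2_eq_square field_simps)

lemma radial_force_derivative:
  assumes "0 < x" "x < pi / 2"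
  shows "(radial_force \<psi>\<^sub>1 \<psi>\<^sub>2 has_real_derivative
     \<psi>\<^sub>1\<^sup>2 * ((1 + (tan x)\<^sup>2) * (1 + 3 * (tan x)\<^sup>2)) + \<psi>\<^sub>2\<^sup>2 * ((1 + (cot x)\<^sup>2) * (1 + 3 * (cot x)\<^sup>2))) (at x)"
proof (rule has_field_derivative_transform_within_open[where S="{0<..<pi / 2}"])
  show "((\<lambda>x. \<psi>\<^sub>1\<^sup>2 * (tan x * (1 + (tan x)\<^sup>2)) - \<psi>\<^sub>2\<^sup>2 * (cot x * (1 + (cot x)\<^sup>2))) has_real_derivative
     \<psi>\<^sub>1\<^sup>2 * ((1 + (tan x)\<^sup>2) * (1 + 3 * (tan x)\<^sup>2)) + \<psi>\<^sub>2\<^sup>2 * ((1 + (cot x)\<^sup>2) * (1 + 3 * (cot x)\<^sup>2))) (at x)"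
    by (rule tan_cot_derivatives(1,2)[OF assms] derivative_eq_intros refl)+
       (simp add: power2_eq_square algebra_simps)
qed (use assms in \<open>auto simp: radial_force_eq\<close>)

lemma abs_le_one_plus_square: "\<bar>u\<bar> \<le> 1 + u\<^sup>2" for u :: real
proof -
  have "2 * \<bar>u\<bar> \<le> 1 + u\<^sup>2" using sum_squares_bound[of 1 "\<bar>u\<bar>"] by simp
  then show ?thesis using abs_ge_zero[of u] by linarith
qed

text \<open>For \<open>a = 0\<close> the quotient is \<open>0\<close> by convention and the bound remains true. So the cases in which
  the tangent or the cotangent term is absent, and \<open>u\<close> is not bounded by the energy, are included.\<close>

lemma quartic_bound_of_quadratic_bound:
  fixes a u E :: real
  assumes "a\<^sup>2 * u\<^sup>2 \<le> E"
  shows "a\<^sup>2 * ((1 + u\<^sup>2) * (1 + 3 * u\<^sup>2)) \<le> a\<^sup>2 + 4 * E + 3 * (E\<^sup>2 / a\<^sup>2)"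
proof -
  have nn: "0 \<le> a\<^sup>2 * u\<^sup>2" by simp
  have "a\<^sup>2 * (u\<^sup>2)\<^sup>2 \<le> E\<^sup>2 / a\<^sup>2"
  proof (cases "a = 0")
    case False
    have "(a\<^sup>2 * u\<^sup>2)\<^sup>2 \<le> E\<^sup>2" using assms nn by (rule power_mono)
    then have "(a\<^sup>2 * u\<^sup>2)\<^sup>2 / a\<^sup>2 \<le> E\<^sup>2 / a\<^sup>2" by (rule divide_right_mono) simp
    moreover have "(a\<^sup>2 * u\<^sup>2)\<^sup>2 / a\<^sup>2 = a\<^sup>2 * (u\<^sup>2)\<^sup>2" using False by (simp add: power2_eq_square)
    ultimately show ?thesis by simp
  qed simp
  moreover have "a\<^sup>2 * ((1 + u\<^sup>2) * (1 + 3 * u\<^sup>2)) = a\<^sup>2 + 4 * (a\<^sup>2 * u\<^sup>2) + 3 * (a\<^sup>2 * (u\<^sup>2)\<^sup>2)"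
    by (simp add: algebra_simps power2_eq_square)
  ultimately show ?thesis using assms by linarith
qed

text \<open>Bounding the two terms separately, instead of their sum, makes this an interval by monotonicity
  of \<open>tan\<close> and \<open>cot\<close> alone.\<close>

definition energy_region :: "real \<Rightarrow> real \<Rightarrow> real \<Rightarrow> real set" where
  "energy_region \<psi>\<^sub>1 \<psi>\<^sub>2 E =
     {x. 0 < x \<and> x < pi / 2 \<and> \<psi>\<^sub>1\<^sup>2 * (tan x)\<^sup>2 \<le> E \<and> \<psi>\<^sub>2\<^sup>2 * (cot x)\<^sup>2 \<le> E}"

lemma convex_energy_region: "convex (energy_region \<psi>\<^sub>1 \<psi>\<^sub>2 E)"
  unfolding is_interval_convex_1[symmetric] is_interval_1
proof (intro ballI allI impI)
  fix x y z assume x: "x \<in> energy_region \<psi>\<^sub>1 \<psi>\<^sub>2 E" and y: "y \<in> energy_region \<psi>\<^sub>1 \<psi>\<^sub>2 E" and z: "x \<le> z \<and> z \<le> y"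
  have b: "0 < x" "0 < z" "z < pi / 2" "y < pi / 2" using x y z by (auto simp: energy_region_def)
  have pos: "0 < tan x" "0 < tan z" using b z tan_gt_zero by auto
  have "tan z \<le> tan y" "tan x \<le> tan z" using b z by (auto intro!: tan_mono_le)
  then have t: "(tan z)\<^sup>2 \<le> (tan y)\<^sup>2" and c: "cot z \<le> cot x"
    using pos by (auto simp: cot_altdef intro: power_mono le_imp_inverse_le)
  have "0 \<le> cot z" using pos by (simp add: cot_altdef)
  then have "(cot z)\<^sup>2 \<le> (cot x)\<^sup>2" using c by (intro power_mono)
  then have "\<psi>\<^sub>2\<^sup>2 * (cot z)\<^sup>2 \<le> \<psi>\<^sub>2\<^sup>2 * (cot x)\<^sup>2" "\<psi>\<^sub>1\<^sup>2 * (tan z)\<^sup>2 \<le> \<psi>\<^sub>1\<^sup>2 * (tan y)\<^sup>2"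
    using t by (auto intro: mult_left_mono)
  then show "z \<in> energy_region \<psi>\<^sub>1 \<psi>\<^sub>2 E"
    using x y b by (auto simp: energy_region_def)
qed

text \<open>The force and its derivative are polynomials in \<open>tan\<close> and \<open>cot\<close> with coefficients \<open>\<psi>\<^sub>1\<^sup>2\<close> and \<open>\<psi>\<^sub>2\<^sup>2\<close>,
  so the energy bound controls them. Making \<open>M\<close> exceed \<open>1 + \<bar>E\<bar>\<close> leaves room for the momentum.\<close>

lemma radial_force_lipschitz:
  obtains M where "lipschitz_force (radial_potential \<psi>\<^sub>1 \<psi>\<^sub>2) (radial_force \<psi>\<^sub>1 \<psi>\<^sub>2) (energy_region \<psi>\<^sub>1 \<psi>\<^sub>2 E) M"
    "1 + \<bar>E\<bar> \<le> M"
proof -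
  define B where "B a = a\<^sup>2 + 4 * \<bar>E\<bar> + 3 * (E\<^sup>2 / a\<^sup>2)" for a :: real
  have B0: "0 \<le> B a" for a by (simp add: B_def)
  define M where "M = B \<psi>\<^sub>1 + B \<psi>\<^sub>2 + 1 + \<bar>E\<bar>"
  let ?J = "energy_region \<psi>\<^sub>1 \<psi>\<^sub>2 E"
  have J: "0 < x" "x < pi / 2" if "x \<in> ?J" for x using that by (auto simp: energy_region_def)
  have B: "\<psi>\<^sub>1\<^sup>2 * ((1 + (tan x)\<^sup>2) * (1 + 3 * (tan x)\<^sup>2)) \<le> B \<psi>\<^sub>1" "\<psi>\<^sub>2\<^sup>2 * ((1 + (cot x)\<^sup>2) * (1 + 3 * (cot x)\<^sup>2)) \<le> B \<psi>\<^sub>2"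
    if "x \<in> ?J" for x
    using quartic_bound_of_quadratic_bound[of \<psi>\<^sub>1 "tan x" E] quartic_bound_of_quadratic_bound[of \<psi>\<^sub>2 "cot x" E]
      that abs_ge_self[of E] unfolding B_def energy_region_def by auto
  have cubic: "\<bar>a\<^sup>2 * (u * (1 + u\<^sup>2))\<bar> \<le> a\<^sup>2 * ((1 + u\<^sup>2) * (1 + 3 * u\<^sup>2))" for a u :: real
  proof -
    have "\<bar>u\<bar> \<le> 1 + 3 * u\<^sup>2"
      using abs_le_one_plus_square[of u] zero_le_power2[of u] by linarith
    then have "a\<^sup>2 * ((1 + u\<^sup>2) * \<bar>u\<bar>) \<le> a\<^sup>2 * ((1 + u\<^sup>2) * (1 + 3 * u\<^sup>2))"
      by (intro mult_left_mono) auto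
    moreover have "\<bar>a\<^sup>2 * (u * (1 + u\<^sup>2))\<bar> = a\<^sup>2 * ((1 + u\<^sup>2) * \<bar>u\<bar>)"
      by (simp add: abs_mult)
    ultimately show ?thesis by simp
  qed
  show ?thesis
  proof (rule that[of M])
    show "1 + \<bar>E\<bar> \<le> M" using B0[of \<psi>\<^sub>1] B0[of \<psi>\<^sub>2] by (simp add: M_def)
    show "lipschitz_force (radial_potential \<psi>\<^sub>1 \<psi>\<^sub>2) (radial_force \<psi>\<^sub>1 \<psi>\<^sub>2) ?J M"
      unfolding lipschitz_force_def
    proof (intro conjI ballI)
      show "convex ?J" by (rule convex_energy_region)
      show "0 \<le> M" using B0[of \<psi>\<^sub>1] B0[of \<psi>\<^sub>2] by (simp add: M_def)
    next
      fix x assume x: "x \<in> ?J"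
      show "(radial_potential \<psi>\<^sub>1 \<psi>\<^sub>2 has_real_derivative radial_force \<psi>\<^sub>1 \<psi>\<^sub>2 x) (at x within ?J)"
        by (rule has_field_derivative_at_within[OF radial_potential_derivative[OF J[OF x]]])
      show "\<bar>radial_force \<psi>\<^sub>1 \<psi>\<^sub>2 x\<bar> \<le> M"
        using B[OF x] cubic[of \<psi>\<^sub>1 "tan x"] cubic[of \<psi>\<^sub>2 "cot x"]
        unfolding radial_force_eq[OF J[OF x]] M_def by linarith
    next
      fix x y assume x: "x \<in> ?J" and y: "y \<in> ?J"
      have "norm (radial_force \<psi>\<^sub>1 \<psi>\<^sub>2 y - radial_force \<psi>\<^sub>1 \<psi>\<^sub>2 x) \<le> M * norm (y - x)"
      proof (rule field_differentiable_bound[OF convex_energy_region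
            has_field_derivative_at_within[OF radial_force_derivative[OF J]] _ y x])
        fix x assume x: "x \<in> ?J"
        have "0 \<le> \<psi>\<^sub>1\<^sup>2 * ((1 + (tan x)\<^sup>2) * (1 + 3 * (tan x)\<^sup>2))" "0 \<le> \<psi>\<^sub>2\<^sup>2 * ((1 + (cot x)\<^sup>2) * (1 + 3 * (cot x)\<^sup>2))"
          by simp_all
        then show "norm (\<psi>\<^sub>1\<^sup>2 * ((1 + (tan x)\<^sup>2) * (1 + 3 * (tan x)\<^sup>2)) + \<psi>\<^sub>2\<^sup>2 * ((1 + (cot x)\<^sup>2) * (1 + 3 * (cot x)\<^sup>2))) \<le> M"
          using B[OF x] unfolding M_def real_norm_def by linarith
      qed
      then show "\<bar>radial_force \<psi>\<^sub>1 \<psi>\<^sub>2 y - radial_force \<psi>\<^sub>1 \<psi>\<^sub>2 x\<bar> \<le> M * \<bar>y - x\<bar>" by simp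
    qed
  qed
qed

lemma trajectory_energy_conserved:
  assumes T: "trajectory f t e th" and V: "\<And>s. s \<in> {0..t} \<Longrightarrow> (V has_real_derivative f (e s)) (at (e s))"
    and s: "s \<in> {0..t}"
  shows "2 * (th s)\<^sup>2 + V (e s) = 2 * (th 0)\<^sup>2 + V (e 0)"
proof -
  let ?H = "\<lambda>s. 2 * (th s)\<^sup>2 + V (e s)"
  have "(?H has_real_derivative 0) (at s within {0..t})" if "s \<in> {0..t}" for s
    by (rule derivative_eq_intros refl trajectoryD[OF T that] DERIV_chain2[where f=V and g=e, OF V[OF that]])+ simp
  then have "\<exists>c. \<forall>s\<in>{0..t}. ?H s = c"
    by (intro has_field_derivative_zero_constant) auto
  then show ?thesis using s by fastforce
qed

lemma hamiltonian_solution_radial: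
  assumes sol: "hamiltonian_solution t z\<^sub>1 z\<^sub>2 e p\<^sub>1 p\<^sub>2 th" and s: "s \<in> {0..t}"
  shows "0 < e s" "e s < pi / 2"
    and "p\<^sub>1 0 = \<psi>\<^sub>1 \<Longrightarrow> p\<^sub>2 0 = \<psi>\<^sub>2 \<Longrightarrow> trajectory (radial_force \<psi>\<^sub>1 \<psi>\<^sub>2) t e th"
proof -
  have eb: "0 < e s" "e s < pi / 2" if "s \<in> {0..t}" for s
    using sol that unfolding hamiltonian_solution_def by blast+
  then show "0 < e s" "e s < pi / 2" using s by blast+
  assume init: "p\<^sub>1 0 = \<psi>\<^sub>1" "p\<^sub>2 0 = \<psi>\<^sub>2"
  have "(p\<^sub>1 has_real_derivative 0) (at s within {0..t}) \<and> (p\<^sub>2 has_real_derivative 0) (at s within {0..t})"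
    if "s \<in> {0..t}" for s
  proof -
    have "(p\<^sub>1 has_real_derivative - deriv (\<lambda>q. Ham q (z\<^sub>2 s) (e s) (p\<^sub>1 s) (p\<^sub>2 s) (th s)) (z\<^sub>1 s)) (at s within {0..t})"
      "(p\<^sub>2 has_real_derivative - deriv (\<lambda>q. Ham (z\<^sub>1 s) q (e s) (p\<^sub>1 s) (p\<^sub>2 s) (th s)) (z\<^sub>2 s)) (at s within {0..t})"
      using sol that unfolding hamiltonian_solution_def by blast+
    then show ?thesis unfolding Ham_partial_derivatives[OF eb[OF that]] by simp
  qed
  then have "\<exists>c. \<forall>s\<in>{0..t}. p\<^sub>1 s = c" "\<exists>c. \<forall>s\<in>{0..t}. p\<^sub>2 s = c"
    by (auto intro!: has_field_derivative_zero_constant)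
  then have p: "p\<^sub>1 s = \<psi>\<^sub>1" "p\<^sub>2 s = \<psi>\<^sub>2" if "s \<in> {0..t}" for s
    using init that by fastforce+
  show "trajectory (radial_force \<psi>\<^sub>1 \<psi>\<^sub>2) t e th"
    unfolding trajectory_def
  proof (intro ballI conjI)
    fix s assume s: "s \<in> {0..t}"
    have "(e has_real_derivative deriv (\<lambda>p. Ham (z\<^sub>1 s) (z\<^sub>2 s) (e s) (p\<^sub>1 s) (p\<^sub>2 s) p) (th s)) (at s within {0..t})"
      "(th has_real_derivative - deriv (\<lambda>q. Ham (z\<^sub>1 s) (z\<^sub>2 s) q (p\<^sub>1 s) (p\<^sub>2 s) (th s)) (e s)) (at s within {0..t})"
      using sol s unfolding hamiltonian_solution_def by blast+
    then show "(e has_real_derivative 4 * th s) (at s within {0..t})"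
      "(th has_real_derivative - radial_force \<psi>\<^sub>1 \<psi>\<^sub>2 (e s)) (at s within {0..t})"
      unfolding Ham_partial_derivatives[OF eb[OF s]] radial_force_def p[OF s] by simp_all
  qed
qed

section \<open>The Hamilton--Jacobi equation\<close>

text \<open>The radial curves are the same for all \<open>\<zeta>\<^sub>1, \<zeta>\<^sub>2\<close>, so the values \<open>\<zeta>\<^sub>1 = \<zeta>\<^sub>2 = 0\<close> suffice to read off their
  equations. Confinement is conservation of energy, with \<open>E\<close> bounding twice the initial value of
  \<open>2\<theta>\<^sup>2 + V\<close>, less \<open>2\<psi>\<^sub>1\<psi>\<^sub>2\<close>.\<close>

lemma solution_branch_trajectory_branch:
  assumes "open D" and D: "D \<subseteq> {0<..<pi / 2} \<times> {0<..}"
    and branch: "solution_branch \<psi>\<^sub>1 \<psi>\<^sub>2 \<eta>\<^sub>0 D z\<^sub>1 z\<^sub>2 e p\<^sub>1 p\<^sub>2 th"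
  shows "trajectory_branch (radial_potential \<psi>\<^sub>1 \<psi>\<^sub>2) (radial_force \<psi>\<^sub>1 \<psi>\<^sub>2) \<eta>\<^sub>0 D e th"
proof -
  have sol: "hamiltonian_solution t (z\<^sub>1 0 0 x t) (z\<^sub>2 0 0 x t) (e x t) (p\<^sub>1 0 0 x t) (p\<^sub>2 0 0 x t) (th x t)"
    and bc: "mixed_boundary_conditions \<psi>\<^sub>1 \<psi>\<^sub>2 \<eta>\<^sub>0 0 0 x t (z\<^sub>1 0 0 x t) (z\<^sub>2 0 0 x t) (e x t) (p\<^sub>1 0 0 x t) (p\<^sub>2 0 0 x t)"
    if "(x, t) \<in> D" for x t
    using branch that unfolding solution_branch_def by blast+
  have pos: "0 < t" if "(x, t) \<in> D" for x t using D that by auto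
  have traj: "trajectory (radial_force \<psi>\<^sub>1 \<psi>\<^sub>2) t (e x t) (th x t)" if "(x, t) \<in> D" for x t
    using hamiltonian_solution_radial(3)[OF sol[OF that], of 0] bc[OF that] pos[OF that]
    by (simp add: mixed_boundary_conditions_def)
  show ?thesis
  proof
    show "open D" by fact
    show "continuous_on D (\<lambda>(x, t). th x t 0)" using branch by (simp add: solution_branch_def)
    show "0 < t" "trajectory (radial_force \<psi>\<^sub>1 \<psi>\<^sub>2) t (e x t) (th x t)" "e x t 0 = \<eta>\<^sub>0" "e x t t = x"
      if "(x, t) \<in> D" for x t
      using pos[OF that] traj[OF that] bc[OF that] by (simp_all add: mixed_boundary_conditions_def)
    fix R
    define E where "E = 4 * R\<^sup>2 + \<psi>\<^sub>1\<^sup>2 * (tan \<eta>\<^sub>0)\<^sup>2 + \<psi>\<^sub>2\<^sup>2 * (cot \<eta>\<^sub>0)\<^sup>2"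
    have E0: "0 \<le> E" by (simp add: E_def)
    obtain M where M: "lipschitz_force (radial_potential \<psi>\<^sub>1 \<psi>\<^sub>2) (radial_force \<psi>\<^sub>1 \<psi>\<^sub>2) (energy_region \<psi>\<^sub>1 \<psi>\<^sub>2 E) M"
      "1 + \<bar>E\<bar> \<le> M"
      by (rule radial_force_lipschitz)
    have "e x t s \<in> energy_region \<psi>\<^sub>1 \<psi>\<^sub>2 E \<and> \<bar>th x t s\<bar> \<le> M"
      if xt: "(x, t) \<in> D" and R: "\<bar>th x t 0\<bar> \<le> R" and s: "s \<in> {0..t}" for x t s
    proof -
      note eb = hamiltonian_solution_radial(1,2)[OF sol[OF xt]]
      have e0: "e x t 0 = \<eta>\<^sub>0" using bc[OF xt] by (simp add: mixed_boundary_conditions_def)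
      have "2 * (th x t s)\<^sup>2 + radial_potential \<psi>\<^sub>1 \<psi>\<^sub>2 (e x t s)
          = 2 * (th x t 0)\<^sup>2 + radial_potential \<psi>\<^sub>1 \<psi>\<^sub>2 (e x t 0)"
        by (rule trajectory_energy_conserved[OF traj[OF xt] radial_potential_derivative[OF eb] s])
      moreover have "(th x t 0)\<^sup>2 \<le> R\<^sup>2" using R by (simp add: abs_le_square_iff[symmetric])
      ultimately have "4 * (th x t s)\<^sup>2 + \<psi>\<^sub>1\<^sup>2 * (tan (e x t s))\<^sup>2 + \<psi>\<^sub>2\<^sup>2 * (cot (e x t s))\<^sup>2 \<le> E"
        unfolding radial_potential_def E_def e0 by linarith
      moreover have "0 \<le> (th x t s)\<^sup>2" "0 \<le> \<psi>\<^sub>1\<^sup>2 * (tan (e x t s))\<^sup>2" "0 \<le> \<psi>\<^sub>2\<^sup>2 * (cot (e x t s))\<^sup>2"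
        by simp_all
      ultimately have "(th x t s)\<^sup>2 \<le> E" "\<psi>\<^sub>1\<^sup>2 * (tan (e x t s))\<^sup>2 \<le> E" "\<psi>\<^sub>2\<^sup>2 * (cot (e x t s))\<^sup>2 \<le> E"
        by linarith+
      moreover have "\<bar>th x t s\<bar> \<le> 1 + (th x t s)\<^sup>2"
        by (rule abs_le_one_plus_square)
      ultimately show ?thesis using eb[OF s] M(2) E0 by (auto simp: energy_region_def)
    qed
    then show "\<exists>J M. lipschitz_force (radial_potential \<psi>\<^sub>1 \<psi>\<^sub>2) (radial_force \<psi>\<^sub>1 \<psi>\<^sub>2) J M \<and>
      (\<forall>x t s. (x, t) \<in> D \<longrightarrow> \<bar>th x t 0\<bar> \<le> R \<longrightarrow> s \<in> {0..t} \<longrightarrow> e x t s \<in> J \<and> \<bar>th x t s\<bar> \<le> M)"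
      using M(1) by blast
  qed
qed

lemma (in trajectory_branch) modified_action_eq_branch_action:
  assumes V: "V = radial_potential \<psi>\<^sub>1 \<psi>\<^sub>2" and D: "(x, t) \<in> D"
  shows "modified_action \<psi>\<^sub>1 \<psi>\<^sub>2 z\<^sub>1 z\<^sub>2 e th \<zeta>\<^sub>1 \<zeta>\<^sub>2 x t = \<psi>\<^sub>1 * \<zeta>\<^sub>1 + \<psi>\<^sub>2 * \<zeta>\<^sub>2 + branch_action x t"
proof -
  have "th x t s * vector_derivative (e x t) (at s within {0..t})
      - Ham (z\<^sub>1 \<zeta>\<^sub>1 \<zeta>\<^sub>2 x t s) (z\<^sub>2 \<zeta>\<^sub>1 \<zeta>\<^sub>2 x t s) (e x t s) \<psi>\<^sub>1 \<psi>\<^sub>2 (th x t s)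
      = 2 * (th x t s)\<^sup>2 - V (e x t s)" if s: "s \<in> {0..t}" for s
  proof -
    have "vector_derivative (e x t) (at s within {0..t}) = 4 * th x t s"
      using time_pos[OF D] s trajectoryD(1)[OF traj[OF D] s]
      by (intro vector_derivative_within_closed_interval)
         (simp_all add: has_real_derivative_iff_has_vector_derivative)
    then show ?thesis by (simp add: Ham_eq_radial V power2_eq_square)
  qed
  then show ?thesis
    unfolding modified_action_def action_def by (subst integral_cong) (assumption, rule refl)
qed

theorem theorem4:
  fixes \<psi>\<^sub>1 \<psi>\<^sub>2 \<eta>\<^sub>0 \<zeta>\<^sub>1 \<zeta>\<^sub>2 \<eta> t :: real
    and D :: "(real \<times> real) set"
    and z\<^sub>1 z\<^sub>2 p\<^sub>1 p\<^sub>2 :: "real \<Rightarrow> real \<Rightarrow> real \<Rightarrow> real \<Rightarrow> real \<Rightarrow> real"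
    and e th :: "real \<Rightarrow> real \<Rightarrow> real \<Rightarrow> real"
  assumes "open D" and "D \<subseteq> {0<..<pi / 2} \<times> {0<..}"
    and "solution_branch \<psi>\<^sub>1 \<psi>\<^sub>2 \<eta>\<^sub>0 D z\<^sub>1 z\<^sub>2 e p\<^sub>1 p\<^sub>2 th"
    and "(\<eta>, t) \<in> D"
  shows "let g = modified_action \<psi>\<^sub>1 \<psi>\<^sub>2 z\<^sub>1 z\<^sub>2 e th in
    (\<lambda>x. g x \<zeta>\<^sub>2 \<eta> t) differentiable at \<zeta>\<^sub>1 \<and>
    (\<lambda>x. g \<zeta>\<^sub>1 x \<eta> t) differentiable at \<zeta>\<^sub>2 \<and>
    (\<lambda>x. g \<zeta>\<^sub>1 \<zeta>\<^sub>2 x t) differentiable at \<eta> \<and>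
    (\<lambda>\<tau>. g \<zeta>\<^sub>1 \<zeta>\<^sub>2 \<eta> \<tau>) differentiable at t \<and>
    deriv (\<lambda>\<tau>. g \<zeta>\<^sub>1 \<zeta>\<^sub>2 \<eta> \<tau>) t
      + Ham \<zeta>\<^sub>1 \<zeta>\<^sub>2 \<eta>
          (deriv (\<lambda>x. g x \<zeta>\<^sub>2 \<eta> t) \<zeta>\<^sub>1)
          (deriv (\<lambda>x. g \<zeta>\<^sub>1 x \<eta> t) \<zeta>\<^sub>2)
          (deriv (\<lambda>x. g \<zeta>\<^sub>1 \<zeta>\<^sub>2 x t) \<eta>) = 0"
proof -
  note D = \<open>(\<eta>, t) \<in> D\<close>
  interpret trajectory_branch "radial_potential \<psi>\<^sub>1 \<psi>\<^sub>2" "radial_force \<psi>\<^sub>1 \<psi>\<^sub>2" \<eta>\<^sub>0 D e th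
    by (rule solution_branch_trajectory_branch[OF assms(1-3)])
  define g where "g = modified_action \<psi>\<^sub>1 \<psi>\<^sub>2 z\<^sub>1 z\<^sub>2 e th"
  have g: "g a b x s = \<psi>\<^sub>1 * a + \<psi>\<^sub>2 * b + branch_action x s" if "(x, s) \<in> D" for a b x s
    unfolding g_def by (rule modified_action_eq_branch_action[OF refl that])
  have d1: "((\<lambda>x. g x \<zeta>\<^sub>2 \<eta> t) has_real_derivative \<psi>\<^sub>1) (at \<zeta>\<^sub>1)"
    and d2: "((\<lambda>x. g \<zeta>\<^sub>1 x \<eta> t) has_real_derivative \<psi>\<^sub>2) (at \<zeta>\<^sub>2)"
    unfolding g[OF D] by (rule derivative_eq_intros refl | simp)+
  have "open {x. (x, t) \<in> D}" "open {s. (\<eta>, s) \<in> D}"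
    using open_vimage[OF open_D, of "\<lambda>x. (x, t)"] open_vimage[OF open_D, of "\<lambda>s. (\<eta>, s)"]
    by (simp_all add: vimage_def continuous_on_Pair)
  then have near: "\<forall>\<^sub>F x in nhds \<eta>. (x, t) \<in> D" "\<forall>\<^sub>F s in nhds t. (\<eta>, s) \<in> D"
    using D by (auto dest: eventually_nhds_in_open)
  have "((\<lambda>x. \<psi>\<^sub>1 * \<zeta>\<^sub>1 + \<psi>\<^sub>2 * \<zeta>\<^sub>2 + branch_action x t) has_real_derivative 0 + th \<eta> t t) (at \<eta>)"
    by (intro DERIV_add DERIV_const branch_action_endpoint_derivative[OF D])
  also have "?this \<longleftrightarrow> ((\<lambda>x. g \<zeta>\<^sub>1 \<zeta>\<^sub>2 x t) has_real_derivative th \<eta> t t) (at \<eta>)"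
    by (rule DERIV_cong_ev) (use near(1) in \<open>auto elim!: eventually_mono simp: g\<close>)
  finally have d3: "((\<lambda>x. g \<zeta>\<^sub>1 \<zeta>\<^sub>2 x t) has_real_derivative th \<eta> t t) (at \<eta>)" .
  have "((\<lambda>s. \<psi>\<^sub>1 * \<zeta>\<^sub>1 + \<psi>\<^sub>2 * \<zeta>\<^sub>2 + branch_action \<eta> s) has_real_derivative
      0 + - (2 * (th \<eta> t t)\<^sup>2 + radial_potential \<psi>\<^sub>1 \<psi>\<^sub>2 \<eta>)) (at t)"
    by (intro DERIV_add DERIV_const branch_action_time_derivative[OF D])
  also have "?this \<longleftrightarrow> (g \<zeta>\<^sub>1 \<zeta>\<^sub>2 \<eta> has_real_derivative
      - (2 * (th \<eta> t t)\<^sup>2 + radial_potential \<psi>\<^sub>1 \<psi>\<^sub>2 \<eta>)) (at t)"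
    by (rule DERIV_cong_ev) (use near(2) in \<open>auto elim!: eventually_mono simp: g\<close>)
  finally have d4: "(g \<zeta>\<^sub>1 \<zeta>\<^sub>2 \<eta> has_real_derivative
      - (2 * (th \<eta> t t)\<^sup>2 + radial_potential \<psi>\<^sub>1 \<psi>\<^sub>2 \<eta>)) (at t)" .
  show ?thesis
    unfolding Let_def g_def[symmetric]
    unfolding DERIV_imp_deriv[OF d1] DERIV_imp_deriv[OF d2] DERIV_imp_deriv[OF d3] DERIV_imp_deriv[OF d4]
    using d1 d2 d3 d4 by (auto simp: Ham_eq_radial real_differentiable_def)
qed

end
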